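(* Let $N\ge 2$ and let $T:\mathcal{M}_N\to\mathcal{M}_N$ be a bistochastic channel such that $\hat T$ is strictly contractive with rate $C\in[0,1)$. Then: (i) $\hat T$ is ergodic, i.e. $X\in\mathcal{M}_N$ satisfies $\hat T(X)=X$ if and only if $X=\chi\mathbf{1}$ for some $\chi\in\mathbb{C}$; (ii) the spectrum of the operator $T\hat T=T\circ\hat T$ on $\mathcal{M}_N$ is contained in $[0,1-\gamma]\cup\{1\}$ for some $\gamma\ge 1-C$, i.e. every eigenvalue of $T\hat T$ other than $1$ lies in $[0,C]$; (iii) for every density matrix $\sigma\in\mathcal{D}_N$, $$S[\hat T(\sigma)]-S(\sigma)\ \ge\ \frac{1-C}{2}\,\big\|\sigma-N^{-1}\mathbf{1}\big\|_2^2 .$$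
   Context: $\mathcal{M}_N$ is the algebra of $N\times N$ complex matrices, $\mathbf{1}$ the identity matrix, $\mathcal{D}_N$ the set of $N\times N$ density matrices (positive semidefinite, trace one). A channel is a linear map $T:\mathcal{M}_N\to\mathcal{M}_N$ (Heisenberg picture) that is unital ($T(\mathbf{1})=\mathbf{1}$) and completely positive. Its Schrödinger-picture dual $\hat T$ is defined by $\mathrm{tr}[\hat T(A)B]=\mathrm{tr}[A\,T(B)]$ for all $A,B\in\mathcal{M}_N$; $\hat T$ is completely positive and trace preserving. $T$ is bistochastic if $T(\mathbf{1})=\hat T(\mathbf{1})=\mathbf{1}$. $\hat T$ is strictly contractive with rate $C\in[0,1)$ if $\|\hat T(\sigma)-\hat T(\sigma')\|_1\le C\|\sigma-\sigma'\|_1$ for all $\sigma,\sigma'\in\mathcal{D}_N$, where $\|A\|_1=\mathrm{tr}(A^*A)^{1/2}$ is the trace norm. $\|A\|_2=[\mathrm{tr}(A^*A)]^{1/2}$ is the Hilbert–Schmidt norm, and $S(\sigma)=-\mathrm{tr}(\sigma\ln\sigma)$ is the von Neumann entropy. $T\hat T$ is regarded as a linear operator on $\mathcal{M}_N$ equipped with the Hilbert–Schmidt inner product $\langle A,B\rangle=\mathrm{tr}(A^*B)$. *)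

theory Defs
  imports "Jordan_Normal_Form.Jordan_Normal_Form" "Jordan_Normal_Form.Schur_Decomposition"
begin

definition mtrace :: "complex mat \<Rightarrow> complex" where
  "mtrace A = (\<Sum>i<dim_row A. A $$ (i, i))"

definition psd :: "nat \<Rightarrow> complex mat \<Rightarrow> bool" where
  "psd n A \<longleftrightarrow> A \<in> carrier_mat n n \<and>
     (\<forall>v \<in> carrier_vec n. Im (conjugate v \<bullet> (A *\<^sub>v v)) = 0 \<and> Re (conjugate v \<bullet> (A *\<^sub>v v)) \<ge> 0)"

definition density :: "nat \<Rightarrow> complex mat set" where
  "density n = {\<sigma>. psd n \<sigma> \<and> mtrace \<sigma> = 1}"

text \<open>Functional calculus trace: tr f(A) = sum of f over eigenvalues counted with
  algebraic multiplicity (used for positive semidefinite A, whose eigenvalues are real).\<close>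
definition trace_fun :: "(real \<Rightarrow> real) \<Rightarrow> complex mat \<Rightarrow> real" where
  "trace_fun f A = (\<Sum>a \<in> {a. poly (char_poly A) a = 0}.
       real (Polynomial.order a (char_poly A)) * f (Re a))"

definition trace_norm :: "complex mat \<Rightarrow> real" where
  "trace_norm A = trace_fun sqrt (mat_adjoint A * A)"

definition hs_norm :: "complex mat \<Rightarrow> real" where
  "hs_norm A = sqrt (Re (mtrace (mat_adjoint A * A)))"

text \<open>von Neumann entropy  S(sigma) = - tr (sigma ln sigma), with 0 ln 0 = 0.\<close>
definition vn_entropy :: "complex mat \<Rightarrow> real" where
  "vn_entropy \<sigma> = - trace_fun (\<lambda>x. x * ln x) \<sigma>"

definition linear_map_on :: "nat \<Rightarrow> (complex mat \<Rightarrow> complex mat) \<Rightarrow> bool" where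
  "linear_map_on n T \<longleftrightarrow>
     (\<forall>A \<in> carrier_mat n n. T A \<in> carrier_mat n n) \<and>
     (\<forall>A \<in> carrier_mat n n. \<forall>B \<in> carrier_mat n n. T (A + B) = T A + T B) \<and>
     (\<forall>c. \<forall>A \<in> carrier_mat n n. T (c \<cdot>\<^sub>m A) = c \<cdot>\<^sub>m T A)"

text \<open>Block (i,j) (of size n x n) of a matrix in M_k(M_n) = M_{kn}.\<close>
definition mblock :: "nat \<Rightarrow> complex mat \<Rightarrow> nat \<Rightarrow> nat \<Rightarrow> complex mat" where
  "mblock n X i j = mat n n (\<lambda>(a, b). X $$ (i * n + a, j * n + b))"

text \<open>The ampliation id_k \<otimes> T acting on M_k(M_n).\<close>
definition ampliation :: "nat \<Rightarrow> nat \<Rightarrow> (complex mat \<Rightarrow> complex mat) \<Rightarrow> complex mat \<Rightarrow> complex mat" where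
  "ampliation k n T X = mat (k * n) (k * n)
     (\<lambda>(r, c). T (mblock n X (r div n) (c div n)) $$ (r mod n, c mod n))"

definition completely_positive :: "nat \<Rightarrow> (complex mat \<Rightarrow> complex mat) \<Rightarrow> bool" where
  "completely_positive n T \<longleftrightarrow>
     (\<forall>k. \<forall>X. psd (k * n) X \<longrightarrow> psd (k * n) (ampliation k n T X))"

text \<open>Channel (Heisenberg picture): linear, unital, completely positive.\<close>
definition channel :: "nat \<Rightarrow> (complex mat \<Rightarrow> complex mat) \<Rightarrow> bool" where
  "channel n T \<longleftrightarrow> linear_map_on n T \<and> T (1\<^sub>m n) = 1\<^sub>m n \<and> completely_positive n T"

definition is_dual :: "nat \<Rightarrow> (complex mat \<Rightarrow> complex mat) \<Rightarrow> (complex mat \<Rightarrow> complex mat) \<Rightarrow> bool" where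
  "is_dual n T Th \<longleftrightarrow> (\<forall>A \<in> carrier_mat n n. Th A \<in> carrier_mat n n) \<and>
     (\<forall>A \<in> carrier_mat n n. \<forall>B \<in> carrier_mat n n. mtrace (Th A * B) = mtrace (A * T B))"

definition strictly_contractive :: "nat \<Rightarrow> (complex mat \<Rightarrow> complex mat) \<Rightarrow> real \<Rightarrow> bool" where
  "strictly_contractive n Th C \<longleftrightarrow> 0 \<le> C \<and> C < 1 \<and>
     (\<forall>\<sigma> \<in> density n. \<forall>\<sigma>' \<in> density n.
        trace_norm (Th \<sigma> - Th \<sigma>') \<le> C * trace_norm (\<sigma> - \<sigma>'))"

definition op_eigenvalue :: "nat \<Rightarrow> (complex mat \<Rightarrow> complex mat) \<Rightarrow> complex \<Rightarrow> bool" where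
  "op_eigenvalue n L \<mu> \<longleftrightarrow> (\<exists>X \<in> carrier_mat n n. X \<noteq> 0\<^sub>m n n \<and> L X = \<mu> \<cdot>\<^sub>m X)"

end

theory Submission
  imports Defs "HOL-Analysis.L2_Norm"
begin

text \<open>
  All three claims follow from the estimate \<open>\<parallel>Th X\<parallel>\<^sub>2\<^sup>2 \<le> C \<parallel>X\<parallel>\<^sub>2\<^sup>2\<close> for traceless \<open>X\<close>.
  To prove it for hermitian \<open>X\<close>, note that \<open>L = T \<circ> Th\<close> is self-adjoint for the Hilbert-Schmidt
  product, so by Cauchy-Schwarz the numbers \<open>\<parallel>L\<^sup>k X\<parallel>\<^sub>2\<close> are log-convex in \<open>k\<close>; on the other hand they
  are at most \<open>\<parallel>L\<^sup>k X\<parallel>\<^sub>1 \<le> C\<^sup>k \<parallel>X\<parallel>\<^sub>1\<close>, because a traceless hermitian matrix is a multiple of a difference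
  of density matrices and \<open>T\<close> does not increase the trace norm. Hence already
  \<open>\<parallel>L X\<parallel>\<^sub>2 \<le> C \<parallel>X\<parallel>\<^sub>2\<close>.

  For the entropy, the spectra \<open>p\<close> of \<open>\<sigma>\<close> and \<open>q\<close> of \<open>Th \<sigma>\<close> are related by a doubly stochastic matrix,
  and \<open>x ln x\<close> has second derivative at least \<open>1\<close> on \<open>(0, 1]\<close>; so the entropy gain is at least half of
  \<open>\<parallel>\<sigma>\<parallel>\<^sub>2\<^sup>2 - \<parallel>Th \<sigma>\<parallel>\<^sub>2\<^sup>2\<close>, to which the estimate is applied after subtracting the maximally mixed state.
\<close>

section \<open>Scalar inequalities\<close>

text \<open>Log-convexity makes the ratios of successive terms nondecreasing, so a first ratio
  \<open>r\<close> above \<open>C\<close> would force growth like \<open>r ^ k\<close>, which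
  eventually beats \<open>K * C ^ k\<close>. Since \<open>K\<close> disappears from the conclusion,
  a comparison between two different norms may be used for the bound without spoiling the
  rate.\<close>

lemma log_convex_geometric_bound:
  fixes h :: "nat \<Rightarrow> real"
  assumes nn: "\<And>k. 0 \<le> h k" and conv: "\<And>k. (h (Suc k))\<^sup>2 \<le> h k * h (Suc (Suc k))"
    and bound: "\<And>k. h k \<le> K * C ^ k" and C: "0 \<le> C"
  shows "h 1 \<le> C * h 0"
proof (rule ccontr)
  assume neg: "\<not> h 1 \<le> C * h 0"
  have h0: "0 < h 0"
  proof (rule ccontr)
    assume "\<not> 0 < h 0"
    hence "h 0 = 0" using nn[of 0] by simp
    with conv[of 0] neg show False by simp
  qed
  define r where "r = h 1 / h 0"
  have r: "C < r" using neg h0 by (simp add: r_def field_simps)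
  hence r0: "0 < r" using C by simp
  have step: "0 < h k \<and> r * h k \<le> h (Suc k)" for k
  proof (induction k)
    case 0
    show ?case using h0 by (simp add: r_def)
  next
    case (Suc k)
    have pos: "0 < h (Suc k)" using Suc r0 by (meson less_le_trans mult_pos_pos)
    have "r * h k * h (Suc k) \<le> (h (Suc k))\<^sup>2"
      using Suc pos by (simp add: power2_eq_square)
    also have "\<dots> \<le> h k * h (Suc (Suc k))" by (rule conv)
    finally have "h k * (r * h (Suc k)) \<le> h k * h (Suc (Suc k))" by (simp add: mult_ac)
    thus ?case using Suc pos by simp
  qed
  have low: "r ^ k * h 0 \<le> h k" for k
  proof (induction k)
    case (Suc k)
    have "r ^ Suc k * h 0 = r * (r ^ k * h 0)" by simp
    also have "\<dots> \<le> r * h k" using Suc r0 by (intro mult_left_mono) auto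
    also have "\<dots> \<le> h (Suc k)" using step by blast
    finally show ?case .
  qed simp
  show False
  \<comment> \<open>The quotient \<open>r / C\<close> makes no sense for \<open>C = 0\<close>; there
    the bound at \<open>k = 1\<close> already contradicts \<open>0 < h 1\<close>.\<close>
  proof (cases "C = 0")
    case True
    thus False using bound[of 1] step[of 1] by simp
  next
    case False
    hence C0: "0 < C" using C by simp
    hence "1 < r / C" using r by simp
    then obtain k where k: "K / h 0 < (r / C) ^ k" using real_arch_pow by blast
    have "r ^ k * h 0 \<le> K * C ^ k" using low[of k] bound[of k] by simp
    hence "(r / C) ^ k \<le> K / h 0" using C0 h0 by (simp add: power_divide field_simps)
    with k show False by simp
  qed
qed

text \<open>As a function of \<open>p\<close>, the difference of the two sides is the
  \<open>f\<close> below. It vanishes at \<open>q\<close>, and its derivative has the sign of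
  \<open>x - q\<close> because \<open>ln\<close> has slope at least 1 on (0, 1]; so \<open>q\<close>
  is its minimum.\<close>

lemma xlnx_strongly_convex:
  fixes p q :: real
  assumes p: "0 \<le> p" "p \<le> 1" and q: "0 < q" "q \<le> 1"
  shows "(p - q)\<^sup>2 / 2 \<le> p * ln p - q * ln q - (ln q + 1) * (p - q)"
proof (cases "p = 0")
  case True
  \<comment> \<open>At \<open>p = 0\<close>, where \<open>f\<close> is not differentiable, the claim
    collapses to \<open>q * q / 2 \<le> q\<close>.\<close>
  have "q * q \<le> q * 1" using q by (intro mult_left_mono) auto
  thus ?thesis using True q by (simp add: power2_eq_square algebra_simps)
next
  case False
  with p have p0: "0 < p" by simp
  define f where "f x = x * ln x - q * ln q - (ln q + 1) * (x - q) - (x - q)\<^sup>2 / 2" for x :: real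
  have der: "(f has_real_derivative (ln x - ln q - (x - q))) (at x)" if "0 < x" for x
    unfolding f_def using that
    by (auto intro!: derivative_eq_intros simp: field_simps)
  have ln_diff: "b - a \<le> ln b - ln a" if "0 < a" "a \<le> b" "b \<le> 1" for a b :: real
  proof -
    have "ln (a / b) \<le> a / b - 1" using that by (intro ln_le_minus_one) auto
    hence "1 - a / b \<le> ln b - ln a" using that by (simp add: ln_div)
    moreover have "(b - a) * b \<le> (b - a) * 1" using that by (intro mult_left_mono) auto
    hence "b - a \<le> 1 - a / b" using that by (simp add: field_simps)
    ultimately show ?thesis by simp
  qed
  have "f q \<le> f p"
  proof (cases "q \<le> p")
    case True
    show ?thesis
    proof (rule DERIV_nonneg_imp_nondecreasing[OF True])
      fix x assume "q \<le> x" "x \<le> p"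
      thus "\<exists>y. (f has_real_derivative y) (at x) \<and> 0 \<le> y"
        using der[of x] ln_diff[of q x] q p by (intro exI[of _ "ln x - ln q - (x - q)"]) auto
    qed
  next
    case False
    hence "p \<le> q" by simp
    thus ?thesis
    proof (rule DERIV_nonpos_imp_nonincreasing)
      fix x assume "p \<le> x" "x \<le> q"
      thus "\<exists>y. (f has_real_derivative y) (at x) \<and> y \<le> 0"
        using der[of x] ln_diff[of x q] q p0 by (intro exI[of _ "ln x - ln q - (x - q)"]) auto
    qed
  qed
  thus ?thesis by (simp add: f_def)
qed

text \<open>The strong convexity inequality for \<open>p i\<close> and \<open>q j\<close> is
  averaged with weight \<open>D j i\<close>. The linear terms cancel within each row because
  \<open>q j\<close> is the mean of \<open>p\<close> under that row; the column sums then turn the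
  remaining averages into plain sums over \<open>p\<close>.\<close>

lemma doubly_stochastic_entropy_gain:
  fixes p q :: "nat \<Rightarrow> real" and D :: "nat \<Rightarrow> nat \<Rightarrow> real"
  assumes D: "\<And>i j. i < n \<Longrightarrow> j < n \<Longrightarrow> 0 \<le> D j i"
    and row: "\<And>j. j < n \<Longrightarrow> (\<Sum>i<n. D j i) = 1" and col: "\<And>i. i < n \<Longrightarrow> (\<Sum>j<n. D j i) = 1"
    and q: "\<And>j. j < n \<Longrightarrow> q j = (\<Sum>i<n. D j i * p i)"
    and p: "\<And>i. i < n \<Longrightarrow> 0 \<le> p i \<and> p i \<le> 1"
  shows "((\<Sum>i<n. (p i)\<^sup>2) - (\<Sum>j<n. (q j)\<^sup>2)) / 2 \<le> (\<Sum>i<n. p i * ln (p i)) - (\<Sum>j<n. q j * ln (q j))"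
proof -
  have term_le: "D j i * ((p i - q j)\<^sup>2 / 2)
      \<le> D j i * (p i * ln (p i) - q j * ln (q j) - (ln (q j) + 1) * (p i - q j))"
    if ij: "i < n" "j < n" for i j
  proof (cases "q j = 0")
    \<comment> \<open>Strong convexity is only available for \<open>q j > 0\<close>. If
      \<open>q j = 0\<close>, each \<open>D j i * p i\<close> vanishes, and both sides are zero
      whichever factor is.\<close>
    case True
    have "(\<Sum>i<n. D j i * p i) = 0" using q[OF ij(2)] True by simp
    hence "D j i * p i = 0"
      using D p ij by (subst (asm) sum_nonneg_eq_0_iff) auto
    thus ?thesis using True by auto
  next
    case False
    have "0 \<le> q j" unfolding q[OF ij(2)] using D p ij by (auto intro!: sum_nonneg)
    moreover have "q j \<le> (\<Sum>i<n. D j i * 1)"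
      unfolding q[OF ij(2)] using D p ij by (intro sum_mono mult_left_mono) auto
    ultimately show ?thesis
      using False row[OF ij(2)] p[OF ij(1)] D[OF ij]
      by (intro mult_left_mono xlnx_strongly_convex) auto
  qed
  \<comment> \<open>Row average of an expression affine in \<open>p i\<close>: the row sum keeps
    \<open>b\<close>, and the mean of \<open>p\<close> is \<open>q j\<close>. Both sides of
    \<open>term_le\<close> are brought to this shape.\<close>
  have weighted: "(\<Sum>i<n. D j i * (a i + b + c * p i)) = (\<Sum>i<n. D j i * a i) + b + c * q j"
    if "j < n" for j b c and a :: "nat \<Rightarrow> real"
  proof -
    have "(\<Sum>i<n. D j i * (a i + b + c * p i))
      = (\<Sum>i<n. D j i * a i) + (\<Sum>i<n. D j i) * b + c * (\<Sum>i<n. D j i * p i)"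
      by (simp add: sum.distrib sum_distrib_left sum_distrib_right algebra_simps)
    thus ?thesis using row[OF that] q[OF that] by simp
  qed
  have swap: "(\<Sum>j<n. \<Sum>i<n. D j i * a i) = (\<Sum>i<n. a i)" for a :: "nat \<Rightarrow> real"
  proof -
    have "(\<Sum>j<n. \<Sum>i<n. D j i * a i) = (\<Sum>i<n. (\<Sum>j<n. D j i) * a i)"
      by (subst sum.swap) (simp add: sum_distrib_right)
    thus ?thesis using col by simp
  qed
  have "(\<Sum>i<n. D j i * ((p i - q j)\<^sup>2 / 2)) = (\<Sum>i<n. D j i * ((p i)\<^sup>2 / 2)) - (q j)\<^sup>2 / 2"
    if "j < n" for j
  proof -
    have "(\<Sum>i<n. D j i * ((p i - q j)\<^sup>2 / 2)) =
      (\<Sum>i<n. D j i * ((p i)\<^sup>2 / 2 + (q j)\<^sup>2 / 2 + (- q j) * p i))"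
      by (intro sum.cong refl) (simp add: power2_diff field_simps)
    also have "\<dots> = (\<Sum>i<n. D j i * ((p i)\<^sup>2 / 2)) + (q j)\<^sup>2 / 2 + (- q j) * q j"
      by (rule weighted[OF that])
    finally show ?thesis by (simp add: power2_eq_square)
  qed
  hence "(\<Sum>j<n. \<Sum>i<n. D j i * ((p i - q j)\<^sup>2 / 2)) = (\<Sum>i<n. (p i)\<^sup>2 / 2) - (\<Sum>j<n. (q j)\<^sup>2 / 2)"
    by (simp add: sum_subtractf swap del: times_divide_eq_right)
  moreover have "(\<Sum>i<n. D j i * (p i * ln (p i) - q j * ln (q j) - (ln (q j) + 1) * (p i - q j)))
      = (\<Sum>i<n. D j i * (p i * ln (p i))) - q j * ln (q j)" if "j < n" for j
  proof -
    have "(\<Sum>i<n. D j i * (p i * ln (p i) - q j * ln (q j) - (ln (q j) + 1) * (p i - q j))) =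
      (\<Sum>i<n. D j i * (p i * ln (p i) + q j + (- (ln (q j) + 1)) * p i))"
      by (intro sum.cong refl) (simp add: algebra_simps)
    also have "\<dots> = (\<Sum>i<n. D j i * (p i * ln (p i))) + q j + (- (ln (q j) + 1)) * q j"
      by (rule weighted[OF that])
    finally show ?thesis by (simp add: algebra_simps)
  qed
  hence "(\<Sum>j<n. \<Sum>i<n. D j i * (p i * ln (p i) - q j * ln (q j) - (ln (q j) + 1) * (p i - q j)))
      = (\<Sum>i<n. p i * ln (p i)) - (\<Sum>j<n. q j * ln (q j))"
    by (simp add: sum_subtractf swap)
  moreover have "(\<Sum>j<n. \<Sum>i<n. D j i * ((p i - q j)\<^sup>2 / 2)) \<le>
      (\<Sum>j<n. \<Sum>i<n. D j i * (p i * ln (p i) - q j * ln (q j) - (ln (q j) + 1) * (p i - q j)))"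
    using term_le by (intro sum_mono) auto
  ultimately show ?thesis by (simp add: sum_divide_distrib diff_divide_distrib)
qed

section \<open>Spectral theorem for hermitian matrices\<close>

lemma mat_adjoint_carrier [simp]:
  "A \<in> carrier_mat m n \<Longrightarrow> mat_adjoint A \<in> carrier_mat n m"
  unfolding mat_adjoint_def by auto

lemma dim_mat_adjoint [simp]:
  "dim_row (mat_adjoint A) = dim_col A" "dim_col (mat_adjoint A) = dim_row A"
  unfolding mat_adjoint_def by auto

lemma index_mat_adjoint [simp]:
  fixes A :: "complex mat"
  assumes "i < dim_col A" "j < dim_row A"
  shows "mat_adjoint A $$ (i, j) = cnj (A $$ (j, i))"
  using assms unfolding mat_adjoint_def by (simp add: mat_of_rows_index)

lemma mat_adjoint_adjoint [simp]: "mat_adjoint (mat_adjoint A) = (A :: complex mat)"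
  by (rule eq_matI) auto

lemma mat_adjoint_add:
  assumes "A \<in> carrier_mat m n" "(B :: complex mat) \<in> carrier_mat m n"
  shows "mat_adjoint (A + B) = mat_adjoint A + mat_adjoint B"
  using assms by (intro eq_matI) auto

lemma mat_adjoint_minus:
  assumes "A \<in> carrier_mat m n" "(B :: complex mat) \<in> carrier_mat m n"
  shows "mat_adjoint (A - B) = mat_adjoint A - mat_adjoint B"
  using assms by (intro eq_matI) auto

lemma mat_adjoint_smult: "mat_adjoint (c \<cdot>\<^sub>m A) = cnj c \<cdot>\<^sub>m mat_adjoint A"
  by (rule eq_matI) auto

lemma mat_adjoint_one [simp]: "mat_adjoint (1\<^sub>m n) = (1\<^sub>m n :: complex mat)"
  by (rule eq_matI) auto

lemma mat_adjoint_mult: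
  assumes "A \<in> carrier_mat m n" "(B :: complex mat) \<in> carrier_mat n p"
  shows "mat_adjoint (A * B) = mat_adjoint B * mat_adjoint A"
  using assms by (intro eq_matI) (auto simp: scalar_prod_def mult.commute intro!: sum.cong)

lemma mat_adjoint_mat_diag_real:
  "mat_adjoint (mat_diag n (\<lambda>i. complex_of_real (d i))) = mat_diag n (\<lambda>i. of_real (d i))"
  by (rule eq_matI) (auto simp: mat_diag_def)

definition hermitian_mat :: "nat \<Rightarrow> complex mat \<Rightarrow> bool" where
  "hermitian_mat n A \<longleftrightarrow> A \<in> carrier_mat n n \<and> mat_adjoint A = A"

definition unitary_mat :: "nat \<Rightarrow> complex mat \<Rightarrow> bool" where
  "unitary_mat n U \<longleftrightarrow> U \<in> carrier_mat n n \<and> mat_adjoint U * U = 1\<^sub>m n \<and> U * mat_adjoint U = 1\<^sub>m n"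

lemma unitary_matI:
  assumes "U \<in> carrier_mat n n" "mat_adjoint U * U = 1\<^sub>m n"
  shows "unitary_mat n U"
  using assms mat_mult_left_right_inverse[of "mat_adjoint U" n U] by (simp add: unitary_mat_def)

lemma unitary_mat_mult:
  assumes "unitary_mat n U" "unitary_mat n V"
  shows "unitary_mat n (U * V)"
proof (rule unitary_matI)
  have U: "U \<in> carrier_mat n n" "mat_adjoint U \<in> carrier_mat n n" "mat_adjoint U * U = 1\<^sub>m n"
    and V: "V \<in> carrier_mat n n" "mat_adjoint V \<in> carrier_mat n n" "mat_adjoint V * V = 1\<^sub>m n"
    using assms by (auto simp: unitary_mat_def)
  show "U * V \<in> carrier_mat n n" using U V by auto
  have "mat_adjoint (U * V) * (U * V) = mat_adjoint V * (mat_adjoint U * (U * V))"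
    using U V by (simp add: mat_adjoint_mult[of _ n n _ n] assoc_mult_mat[of _ n n _ n _ n])
  also have "mat_adjoint U * (U * V) = V"
    using U V by (simp add: assoc_mult_mat[of _ n n _ n _ n, symmetric])
  finally show "mat_adjoint (U * V) * (U * V) = 1\<^sub>m n" using V by simp
qed

text \<open>The columns of \<open>U\<close> are an orthonormal eigenbasis and the values of
  \<open>d\<close> below \<open>n\<close> are the eigenvalues with repetition. Taking
  \<open>d\<close> real confines the notion to hermitian matrices.\<close>

definition spectral_form :: "nat \<Rightarrow> complex mat \<Rightarrow> complex mat \<Rightarrow> (nat \<Rightarrow> real) \<Rightarrow> bool" where
  "spectral_form n A U d \<longleftrightarrow> unitary_mat n U \<and>
     A = U * mat_diag n (\<lambda>i. complex_of_real (d i)) * mat_adjoint U"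

text \<open>A basis starting with \<open>v\<close> is orthogonalised by Gram-Schmidt, which leaves
  the first vector alone. Only a multiple of \<open>v\<close> can be promised as first column, since
  \<open>v\<close> need not be normalised.\<close>

lemma unitary_completion:
  assumes v: "v \<in> carrier_vec n" and v0: "v \<noteq> 0\<^sub>v n"
  obtains W c where "unitary_mat n W" "col W 0 = c \<cdot>\<^sub>v (v :: complex vec)"
proof -
  interpret cof_vec_space n "TYPE(complex)" .
  define b where "b = basis_completion v"
  define ws where "ws = gram_schmidt n b"
  from basis_completion[OF v v0, folded b_def]
  have dist_b: "distinct b" and indep: "\<not> lin_dep (set b)" and b: "set b \<subseteq> carrier_vec n"
    and hdb: "hd b = v" and len_b: "length b = n" by auto
  have n: "n \<noteq> 0" using v v0 by (metis carrier_vecD vec_of_dim_0)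
  from hdb len_b n obtain vs where bv: "b = v # vs" by (cases b, auto)
  from gram_schmidt_result[OF b dist_b indep refl, folded ws_def]
  have ws: "set ws \<subseteq> carrier_vec n" "corthogonal ws" "length ws = n"
    by (auto simp: len_b)
  have wsc: "ws ! j \<in> carrier_vec n" if "j < n" for j using ws that by (metis nth_mem subsetD)
  have hdws: "ws ! 0 = v" using gram_schmidt_hd[OF v, of vs, folded bv] ws n
    unfolding ws_def by (metis hd_conv_nth length_0_conv)
  \<comment> \<open>Gram-Schmidt here yields orthogonal but not normalised vectors;
    \<open>r j\<close> is the length by which column \<open>j\<close> of \<open>W\<close> is
    divided.\<close>
  define r where "r j = sqrt (\<Sum>i<n. (cmod (ws ! j $ i))\<^sup>2)" for j
  have rr: "ws ! j \<bullet>c ws ! j = complex_of_real ((r j)\<^sup>2)" if "j < n" for j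
    using wsc[OF that]
    by (simp add: r_def scalar_prod_def sum_nonneg complex_norm_square[symmetric] lessThan_atLeast0)
  have r0: "r j \<noteq> 0" if "j < n" for j
    using corthogonalD[OF ws(2), of j j] that ws(3) rr[OF that] by auto
  define W where "W = mat n n (\<lambda>(i, j). ws ! j $ i / complex_of_real (r j))"
  have W: "W \<in> carrier_mat n n" by (simp add: W_def)
  have "mat_adjoint W * W = 1\<^sub>m n"
  proof (rule eq_matI)
    fix j k assume "j < dim_row (1\<^sub>m n :: complex mat)" "k < dim_col (1\<^sub>m n :: complex mat)"
    hence jk: "j < n" "k < n" by auto
    have "(mat_adjoint W * W) $$ (j, k) = (\<Sum>i = 0..<n. cnj (W $$ (i, j)) * W $$ (i, k))"
      using W jk by (simp add: scalar_prod_def)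
    also have "\<dots> = (\<Sum>i = 0..<n. ws ! k $ i * cnj (ws ! j $ i)) / (r j * r k)"
      using jk by (simp add: W_def sum_divide_distrib mult.commute)
    also have "(\<Sum>i = 0..<n. ws ! k $ i * cnj (ws ! j $ i)) = ws ! k \<bullet>c ws ! j"
      using wsc[OF jk(1)] wsc[OF jk(2)] by (simp add: scalar_prod_def)
    also have "\<dots> / (r j * r k) = (if j = k then 1 else 0)"
      using corthogonalD[OF ws(2), of k j] jk ws(3) rr r0 by (auto simp: power2_eq_square)
    finally show "(mat_adjoint W * W) $$ (j, k) = 1\<^sub>m n $$ (j, k)" using jk by simp
  qed (use W in auto)
  hence "unitary_mat n W" by (rule unitary_matI[OF W])
  moreover have "col W 0 = (1 / complex_of_real (r 0)) \<cdot>\<^sub>v v"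
    using n v hdws by (intro eq_vecI) (auto simp: W_def)
  ultimately show thesis by (rule that)
qed

lemma four_block_mult_diag:
  assumes "a \<in> carrier_mat 1 1" "b \<in> carrier_mat 1 1" "X \<in> carrier_mat m m" "Y \<in> carrier_mat m m"
  shows "four_block_mat a (0\<^sub>m 1 m) (0\<^sub>m m 1) X * four_block_mat b (0\<^sub>m 1 m) (0\<^sub>m m 1) Y
    = four_block_mat (a * b) (0\<^sub>m 1 m) (0\<^sub>m m 1) (X * (Y :: 'a :: comm_ring_1 mat))"
  using assms by (subst mult_four_block_mat[of _ 1 1 _ m _ m _ _ 1 _ m]) auto

text \<open>Induction on the dimension. In an orthonormal basis that starts with an eigenvector the
  first column is zero below its top entry; by hermiticity so is the first row to the right of it,
  and the induction hypothesis diagonalises the remaining block.\<close>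

lemma spectral_theorem:
  assumes "hermitian_mat n A"
  shows "\<exists>U d. spectral_form n A U d"
  using assms
proof (induction n arbitrary: A)
  case 0
  hence "A = 1\<^sub>m 0 * mat_diag 0 (\<lambda>i. complex_of_real 0) * mat_adjoint (1\<^sub>m 0)"
    by (intro eq_matI) (auto simp: hermitian_mat_def)
  hence "spectral_form 0 A (1\<^sub>m 0) (\<lambda>_. 0)"
    by (simp add: spectral_form_def unitary_mat_def)
  thus ?case by blast
next
  case (Suc m)
  let ?n = "Suc m"
  from Suc.prems have A: "A \<in> carrier_mat ?n ?n" and Ah: "mat_adjoint A = A"
    by (auto simp: hermitian_mat_def)
  \<comment> \<open>An eigenvalue exists because the characteristic polynomial splits over the
    complex numbers into a positive number of linear factors.\<close>
  obtain as where as: "char_poly A = (\<Prod>a\<leftarrow>as. [:- a, 1:])" "length as = ?n"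
    using char_poly_factorized[OF A] by blast
  then obtain e where "poly (char_poly A) e = 0" by (cases as) auto
  hence "eigenvalue A e" using eigenvalue_root_char_poly[OF A] by simp
  then obtain v where v: "v \<in> carrier_vec ?n" "v \<noteq> 0\<^sub>v ?n" "A *\<^sub>v v = e \<cdot>\<^sub>v v"
    using A unfolding eigenvalue_def eigenvector_def by auto
  obtain W c where W: "unitary_mat ?n W" and W0: "col W 0 = c \<cdot>\<^sub>v v"
    using unitary_completion[OF v(1,2)] by blast
  from W have Wc: "W \<in> carrier_mat ?n ?n" "mat_adjoint W \<in> carrier_mat ?n ?n"
    and WW: "mat_adjoint W * W = 1\<^sub>m ?n" "W * mat_adjoint W = 1\<^sub>m ?n"
    by (auto simp: unitary_mat_def)
  define A' where "A' = mat_adjoint W * (A * W)"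
  have A': "A' \<in> carrier_mat ?n ?n" using A Wc by (auto simp: A'_def)
  have A'h: "mat_adjoint A' = A'"
    using A Wc Ah by (simp add: A'_def mat_adjoint_mult[of _ ?n ?n _ ?n] assoc_mult_mat[of _ ?n ?n _ ?n _ ?n])
  have AA': "A = W * A' * mat_adjoint W"
  proof -
    have "W * A' = W * mat_adjoint W * (A * W)"
      unfolding A'_def using A Wc by (intro assoc_mult_mat[symmetric]) auto
    also have "\<dots> = A * W" using A Wc WW by auto
    finally have "W * A' * mat_adjoint W = A * (W * mat_adjoint W)"
      using assoc_mult_mat[OF A Wc] by simp
    thus ?thesis using A WW by simp
  qed
  have "col (A * W) 0 = e \<cdot>\<^sub>v col W 0"
  proof -
    have "col (A * W) 0 = A *\<^sub>v col W 0" using A Wc by (intro eq_vecI) auto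
    also have "\<dots> = c \<cdot>\<^sub>v (A *\<^sub>v v)" unfolding W0 using A v by (simp add: mult_mat_vec)
    finally show ?thesis unfolding v W0 by (auto simp: smult_smult_assoc mult.commute)
  qed
  hence col0: "A' $$ (i, 0) = (if i = 0 then e else 0)" if "i < ?n" for i
  proof -
    have "A' $$ (i, 0) = row (mat_adjoint W) i \<bullet> col (A * W) 0"
      using A Wc that by (simp add: A'_def)
    also have "\<dots> = e * (row (mat_adjoint W) i \<bullet> col W 0)"
      using \<open>col (A * W) 0 = _\<close> Wc that by simp
    also have "row (mat_adjoint W) i \<bullet> col W 0 = (mat_adjoint W * W) $$ (i, 0)"
      using Wc that by simp
    finally show ?thesis using that WW by simp
  qed
  have sym: "A' $$ (i, j) = cnj (A' $$ (j, i))" if "i < ?n" "j < ?n" for i j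
    using index_mat_adjoint[of i A' j] that A' A'h by auto
  have row0: "A' $$ (0, j) = (if j = 0 then e else 0)" if "j < ?n" for j
    using sym[of 0 j] col0[OF that] that by (auto simp: col0)
  \<comment> \<open>Hermiticity at the corner entry makes the eigenvalue real, as
    \<open>spectral_form\<close> demands.\<close>
  have e: "complex_of_real (Re e) = e"
    using sym[of 0 0] col0[of 0] by (simp add: complex_eq_iff)
  define B where "B = mat m m (\<lambda>(i, j). A' $$ (Suc i, Suc j))"
  have "mat_adjoint B = B"
    by (rule eq_matI) (auto simp: B_def sym[symmetric])
  hence "hermitian_mat m B" by (simp add: hermitian_mat_def B_def)
  then obtain U d where U: "spectral_form m B U d" using Suc.IH by blast
  hence Uc: "U \<in> carrier_mat m m" "mat_adjoint U \<in> carrier_mat m m" "mat_adjoint U * U = 1\<^sub>m m"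
    and B: "B = U * mat_diag m (\<lambda>i. complex_of_real (d i)) * mat_adjoint U"
    by (auto simp: spectral_form_def unitary_mat_def)
  \<comment> \<open>The diagonalising matrix of the block, extended by the identity on the
    eigenvector; accordingly \<open>d'\<close> prepends the new eigenvalue and shifts
    \<open>d\<close> by one.\<close>
  define V where "V = four_block_mat (1\<^sub>m 1) (0\<^sub>m 1 m) (0\<^sub>m m 1) U"
  define d' where "d' i = (if i = 0 then Re e else d (i - 1))" for i
  let ?D = "mat_diag ?n (\<lambda>i. complex_of_real (d' i))"
  have V: "V \<in> carrier_mat ?n ?n" using four_block_carrier_mat[of "1\<^sub>m 1" 1 1 U m m] Uc
    by (simp add: V_def)
  have VH: "mat_adjoint V = four_block_mat (1\<^sub>m 1) (0\<^sub>m 1 m) (0\<^sub>m m 1) (mat_adjoint U)"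
    using Uc by (intro eq_matI) (auto simp: V_def)
  have "mat_adjoint V * V = 1\<^sub>m ?n"
    unfolding VH unfolding V_def using Uc by (subst four_block_mult_diag) auto
  hence Vu: "unitary_mat ?n V" by (rule unitary_matI[OF V])
  have D: "?D = four_block_mat (mat 1 1 (\<lambda>_. e)) (0\<^sub>m 1 m) (0\<^sub>m m 1) (mat_diag m (\<lambda>i. of_real (d i)))"
    by (intro eq_matI) (auto simp: mat_diag_def d'_def e)
  have "A' = four_block_mat (mat 1 1 (\<lambda>_. e)) (0\<^sub>m 1 m) (0\<^sub>m m 1) B"
    using A' by (intro eq_matI) (auto simp: B_def row0 col0)
  also have "\<dots> = V * ?D * mat_adjoint V"
    unfolding VH unfolding V_def D B using Uc
    by (simp add: four_block_mult_diag[of _ _ _ m, unfolded One_nat_def] mult_carrier_mat[of _ m m _ m])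
  finally have A'V: "A' = V * ?D * mat_adjoint V" .
  have "A = (W * V) * ?D * mat_adjoint (W * V)"
    unfolding AA' A'V using Wc V
    by (simp add: mat_adjoint_mult[of _ ?n ?n _ ?n] assoc_mult_mat[of _ ?n ?n _ ?n _ ?n]
        mult_carrier_mat[of _ ?n ?n _ ?n])
  with unitary_mat_mult[OF W Vu] have "spectral_form ?n A (W * V) d'"
    by (simp add: spectral_form_def)
  thus ?case by blast
qed

section \<open>Traces, norms and positive semidefinite matrices\<close>

lemma mtrace_mult_comm:
  assumes "A \<in> carrier_mat m n" "B \<in> carrier_mat n m"
  shows "mtrace (A * B) = mtrace (B * A)"
proof -
  have "mtrace (A * B) = (\<Sum>i<m. \<Sum>j<n. A $$ (i, j) * B $$ (j, i))"
    using assms by (auto simp: mtrace_def scalar_prod_def lessThan_atLeast0)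
  also have "\<dots> = (\<Sum>j<n. \<Sum>i<m. B $$ (j, i) * A $$ (i, j))"
    by (subst sum.swap) (simp add: mult.commute)
  also have "\<dots> = mtrace (B * A)"
    using assms by (auto simp: mtrace_def scalar_prod_def lessThan_atLeast0)
  finally show ?thesis .
qed

lemma mtrace_add:
  assumes "A \<in> carrier_mat n n" "B \<in> carrier_mat n n"
  shows "mtrace (A + B) = mtrace A + mtrace B"
  using assms by (simp add: mtrace_def sum.distrib)

lemma mtrace_minus:
  assumes "A \<in> carrier_mat n n" "B \<in> carrier_mat n n"
  shows "mtrace (A - B) = mtrace A - mtrace B"
  using assms by (simp add: mtrace_def sum_subtractf)

lemma mtrace_smult:
  assumes "A \<in> carrier_mat n n"
  shows "mtrace (c \<cdot>\<^sub>m A) = c * mtrace A"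
  using assms by (simp add: mtrace_def sum_distrib_left)

lemma mtrace_one: "mtrace (1\<^sub>m n) = of_nat n"
  by (simp add: mtrace_def)

lemma complex_of_real_nonneg [simp]: "0 \<le> complex_of_real x \<longleftrightarrow> 0 \<le> x"
  by (simp add: less_eq_complex_def)

section \<open>Quadratic forms, rank-one matrices and spectral decompositions\<close>

definition qform :: "complex mat \<Rightarrow> complex vec \<Rightarrow> complex" where
  "qform A v = conjugate v \<bullet> (A *\<^sub>v v)"

lemma qform_sum:
  assumes "A \<in> carrier_mat n n" "v \<in> carrier_vec n"
  shows "qform A v = (\<Sum>i<n. \<Sum>j<n. cnj (v $ i) * (A $$ (i, j) * v $ j))"
  using assms by (simp add: qform_def scalar_prod_def sum_distrib_left lessThan_atLeast0)

text \<open>The order on \<open>complex\<close> compares real parts and requires equal imaginary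
  parts, so a single inequality states both reality and nonnegativity.\<close>

lemma psd_iff_qform:
  "psd n A \<longleftrightarrow> A \<in> carrier_mat n n \<and> (\<forall>v \<in> carrier_vec n. 0 \<le> qform A v)"
  by (auto simp: psd_def qform_def less_eq_complex_def)

text \<open>The rank-one matrix of \<open>v\<close>. It turns quadratic forms into traces, which can
  then be moved between \<open>T\<close> and \<open>Th\<close> by duality.\<close>

definition outer :: "nat \<Rightarrow> complex vec \<Rightarrow> complex mat" where
  "outer n v = mat n n (\<lambda>(i, j). v $ i * cnj (v $ j))"

lemma outer_carrier [simp]: "outer n v \<in> carrier_mat n n"
  by (simp add: outer_def)

lemma mtrace_mult_outer:
  assumes "A \<in> carrier_mat n n" "v \<in> carrier_vec n"
  shows "mtrace (A * outer n v) = qform A v"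
  using assms
  by (simp add: qform_sum[of _ n] mtrace_def outer_def scalar_prod_def lessThan_atLeast0 mult_ac)

lemma qform_outer:
  assumes "v \<in> carrier_vec n" "w \<in> carrier_vec n"
  shows "qform (outer n v) w = complex_of_real ((cmod (conjugate w \<bullet> v))\<^sup>2)"
proof -
  have "qform (outer n v) w = (\<Sum>i<n. cnj (w $ i) * v $ i) * (\<Sum>j<n. cnj (v $ j) * w $ j)"
    unfolding sum_product using assms by (simp add: qform_sum[of _ n] outer_def mult_ac)
  also have "(\<Sum>i<n. cnj (w $ i) * v $ i) = conjugate w \<bullet> v"
    using assms by (simp add: scalar_prod_def lessThan_atLeast0)
  also have "(\<Sum>j<n. cnj (v $ j) * w $ j) = cnj (conjugate w \<bullet> v)"
    using assms by (simp add: scalar_prod_def lessThan_atLeast0 mult.commute)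
  finally show ?thesis by (simp only: complex_norm_square)
qed

lemma psd_outer: "v \<in> carrier_vec n \<Longrightarrow> psd n (outer n v)"
  by (simp add: psd_iff_qform qform_outer del: of_real_power)

lemma qform_col:
  assumes "A \<in> carrier_mat n n" "U \<in> carrier_mat n n" "i < n"
  shows "qform A (col U i) = (mat_adjoint U * (A * U)) $$ (i, i)"
proof -
  have "row (mat_adjoint U) i = conjugate (col U i)"
    using assms by (intro eq_vecI) auto
  moreover have "col (A * U) i = A *\<^sub>v col U i" using assms by (intro eq_vecI) auto
  ultimately show ?thesis using assms by (simp add: qform_def)
qed

text \<open>The trace is basis independent: conjugation by \<open>U\<close> preserves it and puts
  the quadratic forms of the columns on the diagonal.\<close>

lemma mtrace_unitary:
  assumes "unitary_mat n U" "A \<in> carrier_mat n n"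
  shows "mtrace A = (\<Sum>i<n. qform A (col U i))"
proof -
  have U: "U \<in> carrier_mat n n" "mat_adjoint U \<in> carrier_mat n n" "U * mat_adjoint U = 1\<^sub>m n"
    using assms by (auto simp: unitary_mat_def)
  have "(\<Sum>i<n. qform A (col U i)) = mtrace (mat_adjoint U * (A * U))"
    using assms U by (simp add: qform_col[of _ n] mtrace_def)
  also have "\<dots> = mtrace ((A * U) * mat_adjoint U)"
    using assms U by (intro mtrace_mult_comm) auto
  also have "(A * U) * mat_adjoint U = A"
    using assms U by (simp add: assoc_mult_mat[of _ n n _ n _ n])
  finally show ?thesis by simp
qed

lemma spectral_formD:
  assumes "spectral_form n A U d"
  shows "U \<in> carrier_mat n n" "mat_adjoint U \<in> carrier_mat n n" "unitary_mat n U"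
    "mat_adjoint U * U = 1\<^sub>m n" "U * mat_adjoint U = 1\<^sub>m n"
    "A = U * mat_diag n (\<lambda>i. complex_of_real (d i)) * mat_adjoint U"
    "A \<in> carrier_mat n n"
  using assms by (auto simp: spectral_form_def unitary_mat_def intro!: mult_carrier_mat[of _ n n])

lemma hermitian_spectral_form:
  assumes "spectral_form n A U d"
  shows "hermitian_mat n A"
proof -
  note s = spectral_formD[OF assms]
  let ?D = "mat_diag n (\<lambda>i. complex_of_real (d i))"
  have "mat_adjoint (U * ?D * mat_adjoint U) = U * ?D * mat_adjoint U"
    using s(1,2) by (simp add: mat_adjoint_mult[of _ n n _ n] assoc_mult_mat[of _ n n _ n _ n]
      mult_carrier_mat[of _ n n _ n] mat_adjoint_mat_diag_real)
  thus ?thesis using s(6,7) by (simp add: hermitian_mat_def)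
qed

text \<open>Cyclicity moves the leading \<open>U\<close> to the far right; what remains is a
  diagonal matrix times \<open>B\<close> expressed in the eigenbasis of \<open>A\<close>.\<close>

lemma mtrace_spectral_mult:
  assumes s: "spectral_form n A U d" and B: "B \<in> carrier_mat n n"
  shows "mtrace (A * B) = (\<Sum>i<n. complex_of_real (d i) * qform B (col U i))"
proof -
  note U = spectral_formD[OF s]
  let ?D = "mat_diag n (\<lambda>i. complex_of_real (d i))"
  have "mtrace (A * B) = mtrace (U * (?D * (mat_adjoint U * B)))"
    unfolding U(6) using U(1,2) B
    by (simp add: assoc_mult_mat[of _ n n _ n _ n] mult_carrier_mat[of _ n n _ n])
  also have "\<dots> = mtrace ((?D * (mat_adjoint U * B)) * U)"
    using U(1,2) B by (intro mtrace_mult_comm[of _ n n]) (auto simp: mult_carrier_mat[of _ n n _ n])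
  also have "(?D * (mat_adjoint U * B)) * U = ?D * (mat_adjoint U * (B * U))"
    using U(1,2) B
    by (simp add: assoc_mult_mat[of _ n n _ n _ n] mult_carrier_mat[of _ n n _ n])
  also have "\<dots> = mat n n (\<lambda>(i,j). complex_of_real (d i) * (mat_adjoint U * (B * U)) $$ (i, j))"
    using U(1,2) B by (intro mat_diag_mult_left) (auto simp: mult_carrier_mat[of _ n n _ n])
  finally show ?thesis using U(1) B by (simp add: mtrace_def qform_col[of _ n])
qed

lemma qform_spectral:
  assumes s: "spectral_form n A U d" and i: "i < n"
  shows "qform A (col U i) = complex_of_real (d i)"
proof -
  note U = spectral_formD[OF s]
  let ?D = "mat_diag n (\<lambda>i. complex_of_real (d i))"
  have "mat_adjoint U * (A * U) = (mat_adjoint U * U) * ?D * (mat_adjoint U * U)"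
    using U(1,2) unfolding U(6)
    by (simp add: assoc_mult_mat[of _ n n _ n _ n] mult_carrier_mat[of _ n n _ n])
  also have "\<dots> = ?D" unfolding U(4) by (simp add: right_mult_one_mat[of _ n n] left_mult_one_mat[of _ n n])
  finally show ?thesis using qform_col[OF U(7) U(1) i] i by (simp add: mat_diag_def)
qed

lemma spectral_form_minus:
  assumes "spectral_form n A U d" "spectral_form n B U e"
  shows "spectral_form n (A - B) U (\<lambda>i. d i - e i)"
proof -
  note U = spectral_formD[OF assms(1)] and B = spectral_formD(6)[OF assms(2)]
  have D: "mat_diag n (\<lambda>i. complex_of_real (d i - e i)) =
    mat_diag n (\<lambda>i. complex_of_real (d i)) - mat_diag n (\<lambda>i. complex_of_real (e i))"
    by (rule eq_matI) (auto simp: mat_diag_def)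
  have "A - B = U * mat_diag n (\<lambda>i. complex_of_real (d i - e i)) * mat_adjoint U"
    unfolding D using U(1,2) 
    by (subst U(6), subst B) (simp add: mult_minus_distrib_mat[of _ n n _ n] minus_mult_distrib_mat[of _ n n _ _ n]
      mult_carrier_mat[of _ n n _ n])
  thus ?thesis using U(3) by (simp add: spectral_form_def)
qed

lemma spectral_form_smult:
  assumes "spectral_form n A U d"
  shows "spectral_form n (complex_of_real c \<cdot>\<^sub>m A) U (\<lambda>i. c * d i)"
proof -
  note U = spectral_formD[OF assms(1)]
  have D: "mat_diag n (\<lambda>i. complex_of_real (c * d i)) =
    complex_of_real c \<cdot>\<^sub>m mat_diag n (\<lambda>i. complex_of_real (d i))"
    by (rule eq_matI) (auto simp: mat_diag_def)
  have "complex_of_real c \<cdot>\<^sub>m A = U * mat_diag n (\<lambda>i. complex_of_real (c * d i)) * mat_adjoint U"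
    unfolding D using U(1,2) 
    by (subst U(6)) (simp add: mult_smult_distrib[of _ n n _ n] mult_smult_assoc_mat[of _ n n _ n]
      mult_carrier_mat[of _ n n _ n])
  thus ?thesis using U(3) by (simp add: spectral_form_def)
qed

lemma spectral_form_square:
  assumes "spectral_form n A U d"
  shows "spectral_form n (A * A) U (\<lambda>i. (d i)\<^sup>2)"
proof -
  note U = spectral_formD[OF assms(1)]
  let ?D = "mat_diag n (\<lambda>i. complex_of_real (d i))"
  have "A * A = U * ?D * ((mat_adjoint U * U) * (?D * mat_adjoint U))"
    using U(1,2) unfolding U(6)
    by (simp add: assoc_mult_mat[of _ n n _ n _ n] mult_carrier_mat[of _ n n _ n])
  also have "\<dots> = U * (?D * ?D) * mat_adjoint U"
    using U(1,2) unfolding U(4)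
    by (simp add: assoc_mult_mat[of _ n n _ n _ n] mult_carrier_mat[of _ n n _ n]
        left_mult_one_mat[of _ n n] del: mat_diag_diag)
  finally show ?thesis using U(3) by (simp add: spectral_form_def power2_eq_square)
qed

lemma mtrace_spectral:
  assumes "spectral_form n A U d"
  shows "mtrace A = complex_of_real (\<Sum>i<n. d i)"
  using mtrace_unitary[OF spectral_formD(3,7)[OF assms]] qform_spectral[OF assms] by simp

text \<open>One direction evaluates the form at the eigenvectors. For the other, the form at
  \<open>v\<close> is the trace against \<open>outer n v\<close>, which in the eigenbasis is a sum
  of squared moduli weighted by \<open>d\<close>.\<close>

lemma psd_spectral_iff:
  assumes s: "spectral_form n A U d"
  shows "psd n A \<longleftrightarrow> (\<forall>i<n. 0 \<le> d i)"
proof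
  note U = spectral_formD[OF s]
  assume "psd n A"
  thus "\<forall>i<n. 0 \<le> d i"
    using U(1) qform_spectral[OF s] unfolding psd_iff_qform
    by (metis col_carrier_vec carrier_matD(2) complex_of_real_nonneg)
next
  note U = spectral_formD[OF s]
  assume d: "\<forall>i<n. 0 \<le> d i"
  have "0 \<le> qform A v" if v: "v \<in> carrier_vec n" for v
  proof -
    have "qform A v = (\<Sum>i<n. complex_of_real (d i) * qform (outer n v) (col U i))"
      using mtrace_mult_outer[OF U(7) v] mtrace_spectral_mult[OF s, of "outer n v"] by simp
    moreover have "0 \<le> qform (outer n v) (col U i)" if "i < n" for i
      using psd_outer[OF v] U(1) that by (auto simp: psd_iff_qform)
    ultimately show ?thesis using d by (auto intro!: sum_nonneg mult_nonneg_nonneg)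
  qed
  thus "psd n A" using U(7) by (simp add: psd_iff_qform)
qed

lemma qform_adjoint:
  assumes "A \<in> carrier_mat n n" "v \<in> carrier_vec n"
  shows "qform (mat_adjoint A) v = cnj (qform A v)"
proof -
  have "cnj (qform A v) = (\<Sum>i<n. \<Sum>j<n. cnj (v $ j) * (cnj (A $$ (i, j)) * v $ i))"
    using assms by (simp add: qform_sum[of _ n] mult_ac)
  also have "\<dots> = (\<Sum>j<n. \<Sum>i<n. cnj (v $ j) * (cnj (A $$ (i, j)) * v $ i))"
    by (rule sum.swap)
  finally show ?thesis using assms by (simp add: qform_sum[of _ n])
qed

lemma qform_minus:
  assumes "A \<in> carrier_mat n n" "B \<in> carrier_mat n n" "v \<in> carrier_vec n"
  shows "qform (A - B) v = qform A v - qform B v"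
proof -
  have "A - B \<in> carrier_mat n n" using assms by auto
  thus ?thesis using assms by (simp add: qform_sum[of _ n] sum_subtractf algebra_simps)
qed

lemma qform_smult:
  assumes "A \<in> carrier_mat n n" "v \<in> carrier_vec n"
  shows "qform (c \<cdot>\<^sub>m A) v = c * qform A v"
  using assms by (simp add: qform_sum[of _ n] sum_distrib_left mult_ac)

text \<open>The skew part of \<open>A\<close> has vanishing quadratic form, so its spectrum is zero.\<close>

lemma psd_hermitian:
  assumes "psd n A"
  shows "hermitian_mat n A"
proof -
  have A: "A \<in> carrier_mat n n" using assms by (simp add: psd_def)
  define H where "H = \<i> \<cdot>\<^sub>m (A - mat_adjoint A)"
  have "mat_adjoint H = H"
    using A by (intro eq_matI) (auto simp: H_def algebra_simps)
  hence "hermitian_mat n H"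
    using A minus_carrier_mat[of "mat_adjoint A" n n A] by (simp add: hermitian_mat_def H_def)
  then obtain U d where s: "spectral_form n H U d" using spectral_theorem by blast
  note U = spectral_formD[OF s]
  have "qform H v = 0" if "v \<in> carrier_vec n" for v
  proof -
    have "qform A v = cnj (qform A v)"
      using assms that by (auto simp: psd_iff_qform less_eq_complex_def complex_eq_iff)
    thus ?thesis using A that minus_carrier_mat[of "mat_adjoint A" n n A]
      by (simp add: H_def qform_smult[of _ n] qform_minus[of _ n] qform_adjoint[of _ n])
  qed
  hence "d i = 0" if "i < n" for i
    using qform_spectral[OF s that] U(1) that by auto
  hence "mat_diag n (\<lambda>i. complex_of_real (d i)) = 0\<^sub>m n n"
    by (intro eq_matI) (auto simp: mat_diag_def)
  hence H0: "H = 0\<^sub>m n n" using U(1,2,6) by simp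
  have "mat_adjoint A = A"
  proof (rule eq_matI)
    fix i j assume ij: "i < dim_row A" "j < dim_col A"
    have "H $$ (i, j) = 0" using H0 ij A by simp
    thus "mat_adjoint A $$ (i, j) = A $$ (i, j)" using ij A by (simp add: H_def)
  qed (use A in auto)
  thus ?thesis using A by (simp add: hermitian_mat_def)
qed

lemma psd_spectral:
  assumes "psd n A"
  obtains U d where "spectral_form n A U d" "\<And>i. i < n \<Longrightarrow> 0 \<le> d i"
  using spectral_theorem[OF psd_hermitian[OF assms]] psd_spectral_iff assms by blast

lemma mtrace_psd_nonneg:
  assumes "psd n A"
  shows "mtrace A = complex_of_real (Re (mtrace A))" "0 \<le> Re (mtrace A)"
proof -
  obtain U d where s: "spectral_form n A U d" "\<And>i. i < n \<Longrightarrow> 0 \<le> d i"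
    using psd_spectral[OF assms] by blast
  show "mtrace A = complex_of_real (Re (mtrace A))" "0 \<le> Re (mtrace A)"
    using mtrace_spectral[OF s(1)] s(2) by (auto intro!: sum_nonneg)
qed

text \<open>The product itself need not be hermitian, but expanding in the eigenbasis of
  \<open>A\<close> shows its trace as a sum of products of nonnegative numbers.\<close>

lemma psd_mult_trace_nonneg:
  assumes "psd n A" "psd n B"
  shows "0 \<le> mtrace (A * B)"
proof -
  obtain U d where s: "spectral_form n A U d" "\<And>i. i < n \<Longrightarrow> 0 \<le> d i"
    using psd_spectral[OF assms(1)] by blast
  have "0 \<le> qform B (col U i)" if "i < n" for i
    using assms(2) spectral_formD(1)[OF s(1)] that by (auto simp: psd_iff_qform)
  thus ?thesis using assms(2) s(2)
    by (subst mtrace_spectral_mult[OF s(1)]) (auto simp: psd_def intro!: sum_nonneg mult_nonneg_nonneg)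
qed

section \<open>Functional calculus and the trace norm through eigenvalues\<close>

lemma order_prod_linear:
  "Polynomial.order a (\<Prod>x\<leftarrow>xs. [:- x, 1:]) = count_list xs (a :: 'a :: idom)"
proof (induction xs)
  case (Cons x xs)
  have "(\<Prod>x\<leftarrow>xs. [:- x, 1:]) \<noteq> 0" by (auto simp: prod_list_zero_iff)
  hence "[:- x, 1:] * (\<Prod>x\<leftarrow>xs. [:- x, 1:]) \<noteq> 0" by (simp only: mult_eq_0_iff) simp
  hence "Polynomial.order a (\<Prod>x\<leftarrow>x # xs. [:- x, 1:])
    = Polynomial.order a [:- x, 1:] + Polynomial.order a (\<Prod>x\<leftarrow>xs. [:- x, 1:])"
    unfolding list.map prod_list.Cons by (rule order_mult)
  also have "Polynomial.order a [:- x, 1:] = (if a = x then 1 else 0)"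
    using order_power_n_n[of x 1] by (auto intro: order_0I)
  finally show ?case using Cons.IH by auto
qed (auto intro: order_0I)

lemma sum_count_list:
  fixes g :: "'a \<Rightarrow> real"
  assumes "finite S" "set xs \<subseteq> S"
  shows "(\<Sum>a\<in>S. real (count_list xs a) * g a) = sum_list (map g xs)"
  using assms(2)
proof (induction xs)
  case (Cons x xs)
  have "(\<Sum>a\<in>S. real (count_list (x # xs) a) * g a)
    = (\<Sum>a\<in>S. (if x = a then g a else 0) + real (count_list xs a) * g a)"
    by (intro sum.cong) (auto simp: algebra_simps)
  also have "\<dots> = g x + (\<Sum>a\<in>S. real (count_list xs a) * g a)"
    using assms(1) Cons.prems by (simp add: sum.distrib)
  finally show ?case using Cons by simp
qed simp

text \<open>Similarity to a diagonal matrix writes the characteristic polynomial as a product of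
  linear factors over the list \<open>xs\<close> of eigenvalues. The algebraic multiplicity of a
  root is then its number of occurrences in \<open>xs\<close>.\<close>

lemma trace_fun_spectral:
  assumes s: "spectral_form n A U d"
  shows "trace_fun f A = (\<Sum>i<n. f (d i))"
proof -
  note U = spectral_formD[OF s]
  let ?D = "mat_diag n (\<lambda>i. complex_of_real (d i))"
  define xs where "xs = map (\<lambda>i. complex_of_real (d i)) [0..<n]"
  have "similar_mat A ?D"
    using U by (intro similar_matI[of _ _ U "mat_adjoint U" n]) auto
  hence "char_poly A = char_poly ?D" by (rule char_poly_similar)
  also have "\<dots> = (\<Prod>a\<leftarrow>diag_mat ?D. [:- a, 1:])"
    by (rule char_poly_upper_triangular[of _ n]) (auto simp: mat_diag_def)
  also have "diag_mat ?D = xs"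
    by (auto simp: diag_mat_def xs_def mat_diag_def)
  finally have c: "char_poly A = (\<Prod>a\<leftarrow>xs. [:- a, 1:])" .
  have roots: "{a. poly (char_poly A) a = 0} = set xs"
    unfolding c by (auto simp: poly_prod_list prod_list_zero_iff)
  have "trace_fun f A = (\<Sum>a\<in>set xs. real (count_list xs a) * f (Re a))"
    unfolding trace_fun_def roots unfolding c order_prod_linear ..
  also have "\<dots> = sum_list (map (\<lambda>a. f (Re a)) xs)"
    by (rule sum_count_list) auto
  also have "\<dots> = (\<Sum>i<n. f (d i))"
    by (simp add: xs_def o_def interv_sum_list_conv_sum_set_nat lessThan_atLeast0)
  finally show ?thesis .
qed

lemma trace_norm_spectral:
  assumes "spectral_form n A U d"
  shows "trace_norm A = (\<Sum>i<n. \<bar>d i\<bar>)"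
  using trace_fun_spectral[OF spectral_form_square[OF assms], of sqrt]
    hermitian_spectral_form[OF assms]
  by (simp add: trace_norm_def hermitian_mat_def)

text \<open>In the eigenbasis of \<open>P - Q\<close> every eigenvalue is a difference of two
  nonnegative diagonal entries, so its modulus is at most their sum.\<close>

lemma trace_norm_le_psd_parts:
  assumes "psd n P" "psd n Q"
  shows "trace_norm (P - Q) \<le> Re (mtrace P) + Re (mtrace Q)"
proof -
  have PQ: "P \<in> carrier_mat n n" "Q \<in> carrier_mat n n" using assms by (auto simp: psd_def)
  have "hermitian_mat n (P - Q)"
    using psd_hermitian[OF assms(1)] psd_hermitian[OF assms(2)] mat_adjoint_minus[OF PQ]
    by (auto simp: hermitian_mat_def)
  then obtain U d where s: "spectral_form n (P - Q) U d" using spectral_theorem by blast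
  note U = spectral_formD[OF s]
  have "\<bar>d i\<bar> \<le> Re (qform P (col U i)) + Re (qform Q (col U i))" if "i < n" for i
  proof -
    have v: "col U i \<in> carrier_vec n" using U(1) that by auto
    have "complex_of_real (d i) = qform P (col U i) - qform Q (col U i)"
      using qform_spectral[OF s that] qform_minus[OF PQ v] by simp
    hence "d i = Re (qform P (col U i)) - Re (qform Q (col U i))"
      by (metis Re_complex_of_real minus_complex.sel(1))
    moreover have "0 \<le> qform P (col U i)" "0 \<le> qform Q (col U i)"
      using assms v by (auto simp: psd_iff_qform)
    ultimately show ?thesis by (auto simp: less_eq_complex_def)
  qed
  hence "(\<Sum>i<n. \<bar>d i\<bar>) \<le> (\<Sum>i<n. Re (qform P (col U i)) + Re (qform Q (col U i)))"
    by (intro sum_mono) auto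
  also have "\<dots> = Re (mtrace P) + Re (mtrace Q)"
    using mtrace_unitary[OF U(3)] PQ by (simp add: sum.distrib)
  finally show ?thesis using trace_norm_spectral[OF s] by simp
qed

text \<open>The Jordan decomposition, built from the positive and negative parts of the eigenvalues.
  It attains equality in \<open>trace_norm_le_psd_parts\<close>.\<close>

lemma hermitian_psd_parts:
  assumes "hermitian_mat n A"
  obtains P Q where "psd n P" "psd n Q" "A = P - Q"
    "trace_norm A = Re (mtrace P) + Re (mtrace Q)"
proof -
  obtain U d where s: "spectral_form n A U d" using spectral_theorem[OF assms] by blast
  note U = spectral_formD[OF s]
  define M where "M e = U * mat_diag n (\<lambda>i. complex_of_real (e i)) * mat_adjoint U" for e
  have M: "spectral_form n (M e) U e" for e using U(3) by (simp add: spectral_form_def M_def)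
  let ?p = "\<lambda>i. max 0 (d i)" and ?q = "\<lambda>i. max 0 (- d i)"
  have "?p i - ?q i = d i" for i by auto
  hence "A = M ?p - M ?q"
    using spectral_formD(6)[OF spectral_form_minus[OF M M, of ?p ?q]] U(6) by (simp add: M_def)
  moreover have "psd n (M ?p)" "psd n (M ?q)" by (auto simp: psd_spectral_iff[OF M])
  moreover have "trace_norm A = Re (mtrace (M ?p)) + Re (mtrace (M ?q))"
    unfolding trace_norm_spectral[OF s] mtrace_spectral[OF M] Re_complex_of_real
      sum.distrib[symmetric] by (intro sum.cong) auto
  ultimately show thesis using that by blast
qed

lemma trace_norm_smult:
  assumes "hermitian_mat n A"
  shows "trace_norm (complex_of_real c \<cdot>\<^sub>m A) = \<bar>c\<bar> * trace_norm A"
proof -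
  obtain U d where s: "spectral_form n A U d" using spectral_theorem[OF assms] by blast
  show ?thesis
    using trace_norm_spectral[OF s] trace_norm_spectral[OF spectral_form_smult[OF s, of c]]
    by (simp add: abs_mult sum_distrib_left)
qed

section \<open>The Hilbert-Schmidt norm\<close>

lemma mtrace_adjoint_self:
  assumes "A \<in> carrier_mat n n"
  shows "mtrace (mat_adjoint A * A)
    = complex_of_real (\<Sum>p\<in>{..<n} \<times> {..<n}. (cmod (A $$ p))\<^sup>2)"
proof -
  have "mtrace (mat_adjoint A * A) = (\<Sum>i<n. \<Sum>j<n. complex_of_real ((cmod (A $$ (j, i)))\<^sup>2))"
    unfolding complex_norm_square
    using assms by (simp add: mtrace_def scalar_prod_def lessThan_atLeast0 mult.commute)
  also have "\<dots> = (\<Sum>j<n. \<Sum>i<n. complex_of_real ((cmod (A $$ (j, i)))\<^sup>2))"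
    by (rule sum.swap)
  finally show ?thesis by (simp add: sum.cartesian_product case_prod_unfold)
qed

lemma hs_norm_L2_set:
  assumes "A \<in> carrier_mat n n"
  shows "hs_norm A = L2_set (\<lambda>p. cmod (A $$ p)) ({..<n} \<times> {..<n})"
  unfolding hs_norm_def mtrace_adjoint_self[OF assms] by (simp only: L2_set_def Re_complex_of_real)

lemma mtrace_adjoint_mult:
  assumes "A \<in> carrier_mat n n"
  shows "mtrace (mat_adjoint A * A) = complex_of_real ((hs_norm A)\<^sup>2)"
  unfolding hs_norm_def mtrace_adjoint_self[OF assms] Re_complex_of_real
  by (subst real_sqrt_pow2) (simp_all only: sum_nonneg zero_le_power2)

lemma hs_norm_nonneg: "A \<in> carrier_mat n n \<Longrightarrow> 0 \<le> hs_norm A"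
  by (simp add: hs_norm_L2_set[of _ n] L2_set_nonneg)

lemma hs_norm_eq_0:
  assumes "A \<in> carrier_mat n n" "hs_norm A = 0"
  shows "A = 0\<^sub>m n n"
  using assms by (intro eq_matI) (auto simp: hs_norm_L2_set[of _ n] L2_set_eq_0_iff)

lemma hs_cauchy_schwarz:
  assumes "A \<in> carrier_mat n n" "B \<in> carrier_mat n n"
  shows "cmod (mtrace (mat_adjoint A * B)) \<le> hs_norm A * hs_norm B"
proof -
  let ?S = "{..<n} \<times> {..<n}"
  have "mtrace (mat_adjoint A * B) = (\<Sum>i<n. \<Sum>j<n. cnj (A $$ (j, i)) * B $$ (j, i))"
    using assms by (simp add: mtrace_def scalar_prod_def lessThan_atLeast0)
  also have "\<dots> = (\<Sum>j<n. \<Sum>i<n. cnj (A $$ (j, i)) * B $$ (j, i))" by (rule sum.swap)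
  also have "\<dots> = (\<Sum>p\<in>?S. cnj (A $$ p) * B $$ p)"
    by (simp add: sum.cartesian_product case_prod_unfold)
  also have "cmod \<dots> \<le> (\<Sum>p\<in>?S. \<bar>cmod (A $$ p)\<bar> * \<bar>cmod (B $$ p)\<bar>)"
    by (rule order_trans[OF norm_sum]) (simp add: norm_mult)
  also have "\<dots> \<le> L2_set (\<lambda>p. cmod (A $$ p)) ?S * L2_set (\<lambda>p. cmod (B $$ p)) ?S"
    by (rule L2_set_mult_ineq)
  finally show ?thesis using assms by (simp add: hs_norm_L2_set[of _ n])
qed

lemma hs_norm_spectral:
  assumes "spectral_form n A U d"
  shows "(hs_norm A)\<^sup>2 = (\<Sum>i<n. (d i)\<^sup>2)"
proof -
  have "complex_of_real ((hs_norm A)\<^sup>2) = mtrace (A * A)"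
    using mtrace_adjoint_mult[of A n] hermitian_spectral_form[OF assms] by (simp add: hermitian_mat_def)
  also have "\<dots> = complex_of_real (\<Sum>i<n. (d i)\<^sup>2)"
    by (rule mtrace_spectral[OF spectral_form_square[OF assms]])
  finally show ?thesis by (simp only: of_real_eq_iff)
qed

text \<open>On eigenvalues this is the comparison of the Euclidean norm with the sum of absolute
  values.\<close>

lemma hs_norm_le_trace_norm:
  assumes "hermitian_mat n A"
  shows "hs_norm A \<le> trace_norm A"
proof -
  obtain U d where s: "spectral_form n A U d" using spectral_theorem[OF assms] by blast
  have "hs_norm A = L2_set d {..<n}"
    using hs_norm_spectral[OF s] hs_norm_nonneg[of A n] assms
    by (simp add: L2_set_def hermitian_mat_def real_sqrt_unique)
  thus ?thesis using trace_norm_spectral[OF s] L2_set_le_sum_abs[of d "{..<n}"] by simp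
qed

lemma psd_smult:
  assumes "psd n A" "0 \<le> c"
  shows "psd n (complex_of_real c \<cdot>\<^sub>m A)"
  using assms by (auto simp: psd_iff_qform qform_smult[of _ n] intro!: mult_nonneg_nonneg)

text \<open>Pythagoras: a trace-one matrix minus the maximally mixed state is orthogonal to that
  state, whose squared norm is \<open>1 / real n\<close>. The identity is diagonal in every
  eigenbasis, so only the eigenvalues shift.\<close>

lemma hs_norm_minus_maximally_mixed:
  assumes n: "0 < n" and \<sigma>: "hermitian_mat n \<sigma>" and tr: "mtrace \<sigma> = 1"
  shows "(hs_norm (\<sigma> - (1 / of_nat n) \<cdot>\<^sub>m 1\<^sub>m n))\<^sup>2 = (hs_norm \<sigma>)\<^sup>2 - 1 / real n"
proof -
  obtain U d where s: "spectral_form n \<sigma> U d" using spectral_theorem[OF \<sigma>] by blast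
  note U = spectral_formD[OF s]
  have "1\<^sub>m n = U * mat_diag n (\<lambda>i. complex_of_real 1) * mat_adjoint U"
    using U(1,2,5) by simp
  hence "spectral_form n (1\<^sub>m n) U (\<lambda>_. 1)" using U(3) unfolding spectral_form_def by blast
  from spectral_form_minus[OF s spectral_form_smult[OF this, of "1 / real n"]]
  have s': "spectral_form n (\<sigma> - (1 / of_nat n) \<cdot>\<^sub>m 1\<^sub>m n) U (\<lambda>i. d i - 1 / real n)" by simp
  have sum1: "(\<Sum>i<n. d i) = 1"
    using mtrace_spectral[OF s] tr by (metis of_real_eq_1_iff)
  have "(\<Sum>i<n. (d i - 1 / real n)\<^sup>2) = (\<Sum>i<n. (d i)\<^sup>2 + (1 / real n)\<^sup>2 - 2 / real n * d i)"
    by (intro sum.cong) (auto simp: power2_diff)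
  also have "\<dots> = (\<Sum>i<n. (d i)\<^sup>2) + real n * (1 / real n)\<^sup>2 - 2 / real n * (\<Sum>i<n. d i)"
    by (simp add: sum.distrib sum_subtractf sum_distrib_left)
  also have "\<dots> = (\<Sum>i<n. (d i)\<^sup>2) - 1 / real n"
    using n by (simp add: sum1 power2_eq_square field_simps)
  finally show ?thesis using hs_norm_spectral[OF s] hs_norm_spectral[OF s'] by simp
qed

section \<open>Positive maps\<close>

text \<open>Nondegeneracy of the trace pairing, tested on the adjoint of \<open>X - Y\<close>. It
  gives access to \<open>Th\<close>, which is specified through traces.\<close>

lemma mat_eq_by_traces:
  assumes X: "X \<in> carrier_mat n n" and Y: "Y \<in> carrier_mat n n"
    and eq: "\<And>B. B \<in> carrier_mat n n \<Longrightarrow> mtrace (X * B) = mtrace (Y * B)"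
  shows "X = Y"
proof -
  let ?Z = "X - Y"
  have Z: "?Z \<in> carrier_mat n n" "mat_adjoint ?Z \<in> carrier_mat n n"
    using X Y by (auto intro: minus_carrier_mat mat_adjoint_carrier)
  have "mtrace (mat_adjoint ?Z * ?Z) = mtrace (?Z * mat_adjoint ?Z)"
    by (rule mtrace_mult_comm[OF Z(2,1)])
  also have "\<dots> = mtrace (X * mat_adjoint ?Z) - mtrace (Y * mat_adjoint ?Z)"
    unfolding minus_mult_distrib_mat[OF X Y Z(2)]
    using X Y Z by (intro mtrace_minus[of _ n]) auto
  also have "\<dots> = 0" using eq[OF Z(2)] by simp
  finally have "hs_norm ?Z = 0" by (simp add: hs_norm_def)
  hence Z0: "?Z = 0\<^sub>m n n" by (rule hs_norm_eq_0[OF Z(1)])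
  show ?thesis
  proof (rule eq_matI)
    fix i j assume "i < dim_row Y" "j < dim_col Y"
    thus "X $$ (i, j) = Y $$ (i, j)"
      using arg_cong[OF Z0, of "\<lambda>M. M $$ (i, j)"] X Y by auto
  qed (use X Y in auto)
qed

lemma cartesian_decomposition:
  assumes X: "X \<in> carrier_mat n n"
  obtains A B where "hermitian_mat n A" "hermitian_mat n B" "X = A + \<i> \<cdot>\<^sub>m B"
proof
  show "hermitian_mat n ((1/2) \<cdot>\<^sub>m (X + mat_adjoint X))"
    unfolding hermitian_mat_def using X by (auto simp: add.commute intro!: eq_matI)
  have c: "(- \<i>/2) \<cdot>\<^sub>m (X - mat_adjoint X) \<in> carrier_mat n n"
    using X by (auto intro!: minus_carrier_mat)
  have "mat_adjoint ((- \<i>/2) \<cdot>\<^sub>m (X - mat_adjoint X)) = (- \<i>/2) \<cdot>\<^sub>m (X - mat_adjoint X)"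
    using X by (intro eq_matI) (auto simp: algebra_simps)
  with c show "hermitian_mat n ((- \<i>/2) \<cdot>\<^sub>m (X - mat_adjoint X))"
    by (simp add: hermitian_mat_def)
  show "X = (1/2) \<cdot>\<^sub>m (X + mat_adjoint X) + \<i> \<cdot>\<^sub>m ((- \<i>/2) \<cdot>\<^sub>m (X - mat_adjoint X))"
    using X by (intro eq_matI) (auto simp: field_simps)
qed

lemma hermitian_mtrace_real:
  assumes "hermitian_mat n A"
  shows "Im (mtrace A) = 0"
proof -
  obtain U d where "spectral_form n A U d" using spectral_theorem[OF assms] by blast
  from mtrace_spectral[OF this] show ?thesis by simp
qed

lemma adjoint_cartesian:
  assumes "hermitian_mat n A" "hermitian_mat n B"
  shows "mat_adjoint (A + \<i> \<cdot>\<^sub>m B) = A - \<i> \<cdot>\<^sub>m B"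
proof -
  have c: "A \<in> carrier_mat n n" "B \<in> carrier_mat n n" "mat_adjoint A = A" "mat_adjoint B = B"
    using assms by (auto simp: hermitian_mat_def)
  have "mat_adjoint (A + \<i> \<cdot>\<^sub>m B) = mat_adjoint A + cnj \<i> \<cdot>\<^sub>m mat_adjoint B"
    using c(1,2) by (subst mat_adjoint_add[of _ n n]) (auto simp: mat_adjoint_smult)
  thus ?thesis using c by (intro eq_matI) auto
qed

text \<open>The cross terms have traces of \<open>A * B\<close> and \<open>B * A\<close> with
  opposite signs and cancel by cyclicity. Thus bounds for hermitian matrices extend to all matrices
  without loss.\<close>

lemma hs_norm_cartesian:
  assumes "hermitian_mat n A" "hermitian_mat n B"
  shows "(hs_norm (A + \<i> \<cdot>\<^sub>m B))\<^sup>2 = (hs_norm A)\<^sup>2 + (hs_norm B)\<^sup>2"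
proof -
  have c: "A \<in> carrier_mat n n" "B \<in> carrier_mat n n" "mat_adjoint A = A" "mat_adjoint B = B"
    and iB: "\<i> \<cdot>\<^sub>m B \<in> carrier_mat n n"
    using assms by (auto simp: hermitian_mat_def)
  have m: "M * N \<in> carrier_mat n n" if "M \<in> carrier_mat n n" "N \<in> carrier_mat n n" for M N :: "complex mat"
    using that by auto
  have "(A - \<i> \<cdot>\<^sub>m B) * (A + \<i> \<cdot>\<^sub>m B) = A * (A + \<i> \<cdot>\<^sub>m B) - (\<i> \<cdot>\<^sub>m B) * (A + \<i> \<cdot>\<^sub>m B)"
    using c(1) iB by (intro minus_mult_distrib_mat[of _ n n _ _ n]) auto
  also have "\<dots> = (A * A + \<i> \<cdot>\<^sub>m (A * B)) - \<i> \<cdot>\<^sub>m (B * A + \<i> \<cdot>\<^sub>m (B * B))"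
    using c(1,2) iB
    by (simp add: mult_add_distrib_mat[of _ n n _ n] mult_smult_distrib[of _ n n _ n]
        mult_smult_assoc_mat[of _ n n _ n] add_smult_distrib_left_mat[of _ n n] m)
  finally have "mtrace ((A - \<i> \<cdot>\<^sub>m B) * (A + \<i> \<cdot>\<^sub>m B)) =
      mtrace (A * A) + \<i> * mtrace (A * B) - \<i> * (mtrace (B * A) + \<i> * mtrace (B * B))"
    using c(1,2)
    by (simp add: m mtrace_minus[of _ n] mtrace_add[of _ n] mtrace_smult[of _ n])
  also have "\<dots> = mtrace (A * A) + mtrace (B * B)"
    using mtrace_mult_comm[OF c(1,2)] by (simp add: algebra_simps)
  finally have "complex_of_real ((hs_norm (A + \<i> \<cdot>\<^sub>m B))\<^sup>2)
      = complex_of_real ((hs_norm A)\<^sup>2 + (hs_norm B)\<^sup>2)"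
    using mtrace_adjoint_mult[of "A + \<i> \<cdot>\<^sub>m B" n] mtrace_adjoint_mult[of A n]
      mtrace_adjoint_mult[of B n] c iB adjoint_cartesian[OF assms] by simp
  thus ?thesis by (simp only: of_real_eq_iff)
qed

definition positive_map :: "nat \<Rightarrow> (complex mat \<Rightarrow> complex mat) \<Rightarrow> bool" where
  "positive_map n F \<longleftrightarrow> linear_map_on n F \<and> (\<forall>X. psd n X \<longrightarrow> psd n (F X))"

lemma linear_map_onD:
  assumes "linear_map_on n F"
  shows "A \<in> carrier_mat n n \<Longrightarrow> F A \<in> carrier_mat n n"
    "A \<in> carrier_mat n n \<Longrightarrow> B \<in> carrier_mat n n \<Longrightarrow> F (A + B) = F A + F B"
    "A \<in> carrier_mat n n \<Longrightarrow> F (c \<cdot>\<^sub>m A) = c \<cdot>\<^sub>m F A"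
  using assms by (auto simp: linear_map_on_def)

lemma mat_minus_add_smult:
  "A \<in> carrier_mat n n \<Longrightarrow> B \<in> carrier_mat n n \<Longrightarrow> A - B = A + (-1 :: complex) \<cdot>\<^sub>m B"
  by (intro eq_matI) auto

lemma linear_map_on_minus:
  assumes F: "linear_map_on n F" and A: "A \<in> carrier_mat n n" and B: "B \<in> carrier_mat n n"
  shows "F (A - B) = F A - F B"
  using linear_map_onD[OF F] A B by (simp add: mat_minus_add_smult[of _ n])

text \<open>By the Jordan decomposition the image is a difference of positive semidefinite, hence
  hermitian, matrices.\<close>

lemma positive_map_hermitian:
  assumes F: "positive_map n F" and A: "hermitian_mat n A"
  shows "hermitian_mat n (F A)"
proof -
  have lin: "linear_map_on n F" and pos: "\<And>X. psd n X \<Longrightarrow> psd n (F X)"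
    using F by (auto simp: positive_map_def)
  obtain P Q where PQ: "psd n P" "psd n Q" "A = P - Q" using hermitian_psd_parts[OF A] by metis
  have c: "P \<in> carrier_mat n n" "Q \<in> carrier_mat n n" using PQ by (auto simp: psd_def)
  have "F A = F P - F Q" unfolding PQ(3) by (rule linear_map_on_minus[OF lin c])
  moreover have "hermitian_mat n (F P)" "hermitian_mat n (F Q)"
    using pos PQ psd_hermitian by auto
  ultimately show ?thesis
    using mat_adjoint_minus[of "F P" n n "F Q"] by (auto simp: hermitian_mat_def)
qed

lemma positive_map_cartesian:
  assumes F: "positive_map n F" and A: "hermitian_mat n A" and B: "hermitian_mat n B"
  shows "F (A + \<i> \<cdot>\<^sub>m B) = F A + \<i> \<cdot>\<^sub>m F B"
proof -
  have "linear_map_on n F" using F by (auto simp: positive_map_def)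
  from linear_map_onD[OF this] A B show ?thesis by (simp add: hermitian_mat_def)
qed

lemma positive_map_adjoint:
  assumes F: "positive_map n F" and X: "X \<in> carrier_mat n n"
  shows "F (mat_adjoint X) = mat_adjoint (F X)"
proof -
  have lin: "linear_map_on n F" using F by (auto simp: positive_map_def)
  obtain A B where AB: "hermitian_mat n A" "hermitian_mat n B" "X = A + \<i> \<cdot>\<^sub>m B"
    using cartesian_decomposition[OF X] by metis
  have c: "A \<in> carrier_mat n n" "B \<in> carrier_mat n n" using AB by (auto simp: hermitian_mat_def)
  have "F (mat_adjoint X) = F A - \<i> \<cdot>\<^sub>m F B"
    using linear_map_on_minus[OF lin c(1)] linear_map_onD(3)[OF lin c(2)] c
    unfolding AB(3) adjoint_cartesian[OF AB(1,2)] by simp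
  also have "\<dots> = mat_adjoint (F X)"
    unfolding AB(3) positive_map_cartesian[OF F AB(1,2)]
    using adjoint_cartesian[OF positive_map_hermitian[OF F AB(1)] positive_map_hermitian[OF F AB(2)]]
    by simp
  finally show ?thesis .
qed

text \<open>The images of the Jordan parts are positive semidefinite with unchanged traces, so they
  bound the trace norm of the image, although they need not be its Jordan parts.\<close>

lemma trace_norm_positive_map_le:
  assumes F: "positive_map n F" and A: "hermitian_mat n A"
    and tr: "\<And>X. X \<in> carrier_mat n n \<Longrightarrow> mtrace (F X) = mtrace X"
  shows "trace_norm (F A) \<le> trace_norm A"
proof -
  have lin: "linear_map_on n F" and pos: "\<And>X. psd n X \<Longrightarrow> psd n (F X)"
    using F by (auto simp: positive_map_def)
  obtain P Q where PQ: "psd n P" "psd n Q" "A = P - Q"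
    "trace_norm A = Re (mtrace P) + Re (mtrace Q)" using hermitian_psd_parts[OF A] by metis
  have c: "P \<in> carrier_mat n n" "Q \<in> carrier_mat n n" using PQ by (auto simp: psd_def)
  have "F A = F P - F Q" unfolding PQ(3) by (rule linear_map_on_minus[OF lin c])
  thus ?thesis using trace_norm_le_psd_parts[OF pos[OF PQ(1)] pos[OF PQ(2)]] tr c PQ(4) by simp
qed

text \<open>The ampliation with \<open>k = 1\<close> is the map itself.\<close>

lemma completely_positive_psd:
  assumes cp: "completely_positive n T" and X: "psd n X" and TX: "T X \<in> carrier_mat n n"
  shows "psd n (T X)"
proof -
  have Xc: "X \<in> carrier_mat n n" using X by (simp add: psd_def)
  have "mblock n X 0 0 = X" using Xc by (intro eq_matI) (auto simp: mblock_def)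
  hence "ampliation 1 n T X = T X" using TX by (intro eq_matI) (auto simp: ampliation_def)
  thus ?thesis using cp X unfolding completely_positive_def by (metis nat_mult_1)
qed

section \<open>Bistochastic channels\<close>

locale bistochastic_channel =
  fixes n :: nat and T Th :: "complex mat \<Rightarrow> complex mat"
  assumes channel: "channel n T" and dual: "is_dual n T Th" and Th_one: "Th (1\<^sub>m n) = 1\<^sub>m n"
begin

lemma T_positive: "positive_map n T"
  using channel completely_positive_psd linear_map_onD(1)
  unfolding channel_def positive_map_def by (metis psd_def)

lemma T_linear: "linear_map_on n T"
  using T_positive by (simp add: positive_map_def)

lemma T_carrier: "A \<in> carrier_mat n n \<Longrightarrow> T A \<in> carrier_mat n n"
  using linear_map_onD(1)[OF T_linear] .

lemma Th_carrier: "A \<in> carrier_mat n n \<Longrightarrow> Th A \<in> carrier_mat n n"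
  using dual by (simp add: is_dual_def)

lemma mtrace_dual:
  "A \<in> carrier_mat n n \<Longrightarrow> B \<in> carrier_mat n n \<Longrightarrow> mtrace (Th A * B) = mtrace (A * T B)"
  using dual by (simp add: is_dual_def)

lemma Th_linear: "linear_map_on n Th"
  unfolding linear_map_on_def
proof (intro conjI ballI allI)
  fix A B :: "complex mat" assume A: "A \<in> carrier_mat n n" and B: "B \<in> carrier_mat n n"
  show "Th (A + B) = Th A + Th B"
  proof (rule mat_eq_by_traces[of _ n])
    fix M :: "complex mat" assume M: "M \<in> carrier_mat n n"
    have "mtrace (Th (A + B) * M) = mtrace (A * T M + B * T M)"
      using A B M T_carrier[OF M] by (simp add: mtrace_dual add_mult_distrib_mat[of _ n n])
    also have "\<dots> = mtrace (Th A * M) + mtrace (Th B * M)"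
      using A B M T_carrier[OF M] mult_carrier_mat[of _ n n "T M" n] by (simp add: mtrace_dual mtrace_add[of _ n])
    also have "\<dots> = mtrace ((Th A + Th B) * M)"
      using Th_carrier[OF A] Th_carrier[OF B] M mult_carrier_mat[of _ n n M n]
      by (simp add: add_mult_distrib_mat[of _ n n] mtrace_add[of _ n])
    finally show "mtrace (Th (A + B) * M) = mtrace ((Th A + Th B) * M)" .
  qed (use A B Th_carrier in auto)
next
  fix c and A :: "complex mat" assume A: "A \<in> carrier_mat n n"
  show "Th (c \<cdot>\<^sub>m A) = c \<cdot>\<^sub>m Th A"
  proof (rule mat_eq_by_traces[of _ n])
    fix M :: "complex mat" assume M: "M \<in> carrier_mat n n"
    have "mtrace (Th (c \<cdot>\<^sub>m A) * M) = c * mtrace (Th A * M)"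
      using A M T_carrier[OF M] mult_carrier_mat[of _ n n "T M" n]
      by (simp add: mtrace_dual mult_smult_assoc_mat[of _ n n] mtrace_smult[of _ n])
    also have "\<dots> = mtrace ((c \<cdot>\<^sub>m Th A) * M)"
      using Th_carrier[OF A] M mult_carrier_mat[of _ n n M n]
      by (simp add: mult_smult_assoc_mat[of _ n n] mtrace_smult[of _ n])
    finally show "mtrace (Th (c \<cdot>\<^sub>m A) * M) = mtrace ((c \<cdot>\<^sub>m Th A) * M)" .
  qed (use A Th_carrier in auto)
qed (rule Th_carrier)

lemma qform_Th:
  assumes "A \<in> carrier_mat n n" "v \<in> carrier_vec n"
  shows "qform (Th A) v = mtrace (A * T (outer n v))"
  using mtrace_mult_outer[OF Th_carrier assms(2)] mtrace_dual[of A "outer n v"] assms by simp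

text \<open>By duality the quadratic form of \<open>Th X\<close> at \<open>v\<close> is the trace of
  \<open>X\<close> times \<open>T (outer n v)\<close>, a product of two positive semidefinite
  matrices.\<close>

lemma Th_positive: "positive_map n Th"
  unfolding positive_map_def
proof (intro conjI allI impI Th_linear)
  fix X assume X: "psd n X"
  hence Xc: "X \<in> carrier_mat n n" by (simp add: psd_def)
  have "0 \<le> qform (Th X) v" if "v \<in> carrier_vec n" for v
    using qform_Th[OF Xc that] psd_mult_trace_nonneg[OF X] T_positive psd_outer[OF that]
    by (simp add: positive_map_def)
  thus "psd n (Th X)" using Th_carrier[OF Xc] by (simp add: psd_iff_qform)
qed

text \<open>Trace preservation is unitality of the dual partner: of \<open>T\<close> here, of
  \<open>Th\<close> in \<open>mtrace_T\<close>.\<close>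

lemma mtrace_Th: "A \<in> carrier_mat n n \<Longrightarrow> mtrace (Th A) = mtrace A"
  using mtrace_dual[of A "1\<^sub>m n"] Th_carrier[of A] channel
  by (simp add: channel_def)

lemma mtrace_T: "A \<in> carrier_mat n n \<Longrightarrow> mtrace (T A) = mtrace A"
  using mtrace_dual[of "1\<^sub>m n" A] T_carrier[of A] by (simp add: Th_one)

section \<open>Contraction on traceless matrices\<close>

lemma trace_norm_Th_traceless:
  assumes sc: "strictly_contractive n Th C" and X: "hermitian_mat n X" and tr: "mtrace X = 0"
  shows "trace_norm (Th X) \<le> C * trace_norm X"
proof -
  obtain P Q where PQ: "psd n P" "psd n Q" "X = P - Q"
    "trace_norm X = Re (mtrace P) + Re (mtrace Q)" using hermitian_psd_parts[OF X] by metis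
  have c: "P \<in> carrier_mat n n" "Q \<in> carrier_mat n n" "X \<in> carrier_mat n n"
    using PQ(1,2) X by (auto simp: psd_def hermitian_mat_def)
  \<comment> \<open>Tracelessness gives both Jordan parts the same trace \<open>t\<close>. Dividing
    by \<open>t\<close> makes them density matrices, to which strict contractivity applies; for
    \<open>t = 0\<close> the trace norm of \<open>X\<close> is already zero.\<close>
  define t where "t = Re (mtrace P)"
  have tPQ: "mtrace P = complex_of_real t" "mtrace Q = complex_of_real t"
    using tr mtrace_minus[OF c(1,2)] mtrace_psd_nonneg(1)[OF PQ(1)] PQ(3) by (auto simp: t_def)
  have t0: "0 \<le> t" using mtrace_psd_nonneg(2)[OF PQ(1)] by (simp add: t_def)
  show ?thesis
  proof (cases "t = 0")
    case True
    hence "trace_norm X = 0" using PQ(4) tPQ by simp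
    thus ?thesis using trace_norm_positive_map_le[OF Th_positive X mtrace_Th] by simp
  next
    case False
    with t0 have t: "0 < t" by simp
    let ?c = "complex_of_real (1 / t)"
    have d: "?c \<cdot>\<^sub>m P \<in> density n" "?c \<cdot>\<^sub>m Q \<in> density n"
      using psd_smult[OF PQ(1), of "1 / t"] psd_smult[OF PQ(2), of "1 / t"] t tPQ c
      by (auto simp: density_def mtrace_smult[of _ n])
    have "?c \<cdot>\<^sub>m P - ?c \<cdot>\<^sub>m Q = ?c \<cdot>\<^sub>m X"
      unfolding PQ(3) using c(1,2) by (intro eq_matI) (auto simp: algebra_simps)
    moreover have "Th (?c \<cdot>\<^sub>m P) - Th (?c \<cdot>\<^sub>m Q) = ?c \<cdot>\<^sub>m Th X"
      using linear_map_on_minus[OF Th_linear, of "?c \<cdot>\<^sub>m P" "?c \<cdot>\<^sub>m Q"] c(1,2)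
        linear_map_onD(3)[OF Th_linear c(3), of ?c] calculation by simp
    ultimately have "trace_norm (?c \<cdot>\<^sub>m Th X) \<le> C * trace_norm (?c \<cdot>\<^sub>m X)"
      using sc d unfolding strictly_contractive_def by metis
    thus ?thesis
      unfolding trace_norm_smult[OF X] trace_norm_smult[OF positive_map_hermitian[OF Th_positive X]]
      using t by (simp add: field_simps)
  qed
qed

text \<open>Duality rewrites the squared norm of \<open>Th X\<close> as the inner product of
  \<open>X\<close> with \<open>T (Th X)\<close>, to which Cauchy-Schwarz applies.\<close>

lemma hs_norm_Th_le_geometric_mean:
  assumes X: "hermitian_mat n X"
  shows "(hs_norm (Th X))\<^sup>2 \<le> hs_norm X * hs_norm (T (Th X))"
proof -
  have ThX: "hermitian_mat n (Th X)" by (rule positive_map_hermitian[OF Th_positive X])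
  have c: "X \<in> carrier_mat n n" "mat_adjoint X = X" "Th X \<in> carrier_mat n n"
    "mat_adjoint (Th X) = Th X" using X ThX by (auto simp: hermitian_mat_def)
  have "complex_of_real ((hs_norm (Th X))\<^sup>2) = mtrace (mat_adjoint X * T (Th X))"
    using mtrace_adjoint_mult[OF c(3)] mtrace_dual[OF c(1,3)] c(2,4) by simp
  hence "(hs_norm (Th X))\<^sup>2 = cmod (mtrace (mat_adjoint X * T (Th X)))"
    by (metis abs_power2 norm_of_real real_norm_def)
  thus ?thesis using hs_cauchy_schwarz[OF c(1) T_carrier[OF c(3)]] by simp
qed

lemma hs_norm_Th_hermitian:
  assumes sc: "strictly_contractive n Th C" and X: "hermitian_mat n X" and tr: "mtrace X = 0"
  shows "(hs_norm (Th X))\<^sup>2 \<le> C * (hs_norm X)\<^sup>2"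
proof -
  have C: "0 \<le> C" using sc by (simp add: strictly_contractive_def)
  define L where "L = T \<circ> Th"
  define x where "x k = (L ^^ k) X" for k
  define h where "h k = hs_norm (x k)" for k
  have x_Suc: "x (Suc k) = T (Th (x k))" for k by (simp add: x_def L_def)
  have herm: "hermitian_mat n (x k) \<and> mtrace (x k) = 0" for k
  proof (induction k)
    case 0
    show ?case using X tr by (simp add: x_def)
  next
    case (Suc k)
    hence c: "x k \<in> carrier_mat n n" by (simp add: hermitian_mat_def)
    show ?case unfolding x_Suc
      using Suc c Th_carrier[OF c] mtrace_T mtrace_Th positive_map_hermitian[OF T_positive]
        positive_map_hermitian[OF Th_positive] by auto
  qed
  have c: "x k \<in> carrier_mat n n" "mat_adjoint (x k) = x k" for k
    using herm by (auto simp: hermitian_mat_def)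
  have tn: "trace_norm (x k) \<le> C ^ k * trace_norm X" for k
  proof (induction k)
    case 0
    show ?case by (simp add: x_def)
  next
    case (Suc k)
    \<comment> \<open>Each iteration gains one factor \<open>C\<close> from \<open>Th\<close>, while
      \<open>T\<close> merely does not increase the trace norm.\<close>
    have "trace_norm (x (Suc k)) \<le> trace_norm (Th (x k))"
      unfolding x_Suc using herm positive_map_hermitian[OF Th_positive] mtrace_T
      by (intro trace_norm_positive_map_le[OF T_positive]) auto
    also have "\<dots> \<le> C * trace_norm (x k)"
      using trace_norm_Th_traceless[OF sc] herm by blast
    also have "\<dots> \<le> C * (C ^ k * trace_norm X)" using Suc C by (intro mult_left_mono)
    finally show ?case by (simp add: mult_ac)
  qed
  have "h 1 \<le> C * h 0"
  proof (rule log_convex_geometric_bound[where K = "trace_norm X"])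
    fix k
    show "0 \<le> h k" using hs_norm_nonneg[OF c(1)] by (simp add: h_def)
    show "h k \<le> trace_norm X * C ^ k"
      using tn[of k] hs_norm_le_trace_norm[of n "x k"] herm by (fastforce simp: h_def mult.commute)
    have Thc: "Th (x k) \<in> carrier_mat n n" for k by (rule Th_carrier[OF c(1)])
    \<comment> \<open>Self-adjointness of \<open>L\<close>: one factor \<open>T \<circ> Th\<close>
      is carried from the right entry to the left, so that the inner product of
      \<open>x (Suc k)\<close> with itself becomes that of \<open>x k\<close> with
      \<open>x (Suc (Suc k))\<close>.\<close>
    have "complex_of_real ((h (Suc k))\<^sup>2) = mtrace (x (Suc k) * T (Th (x k)))"
      using mtrace_adjoint_mult[OF c(1)[of "Suc k"]] c(2)[of "Suc k"] by (simp add: h_def x_Suc)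
    also have "\<dots> = mtrace (Th (x (Suc k)) * Th (x k))"
      by (rule mtrace_dual[symmetric, OF c(1) Thc])
    also have "\<dots> = mtrace (Th (x k) * Th (x (Suc k)))"
      by (rule mtrace_mult_comm[OF Thc Thc])
    also have "\<dots> = mtrace (x k * T (Th (x (Suc k))))"
      by (rule mtrace_dual[OF c(1) Thc])
    also have "\<dots> = mtrace (mat_adjoint (x k) * x (Suc (Suc k)))"
      using c(2) by (simp add: x_Suc)
    finally have "(h (Suc k))\<^sup>2 = cmod (mtrace (mat_adjoint (x k) * x (Suc (Suc k))))"
      by (metis abs_power2 norm_of_real real_norm_def)
    thus "(h (Suc k))\<^sup>2 \<le> h k * h (Suc (Suc k))"
      using hs_cauchy_schwarz[OF c(1) c(1)] by (simp add: h_def)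
  qed (rule C)
  hence "hs_norm (T (Th X)) \<le> C * hs_norm X" by (simp add: h_def x_def L_def)
  hence "hs_norm X * hs_norm (T (Th X)) \<le> hs_norm X * (C * hs_norm X)"
    using hs_norm_nonneg[of X n] X by (intro mult_left_mono) (auto simp: hermitian_mat_def)
  thus ?thesis using hs_norm_Th_le_geometric_mean[OF X] by (simp add: power2_eq_square mult_ac)
qed

text \<open>Hermitian matrices have real trace, so both Cartesian parts of \<open>X\<close> are
  traceless. Their bounds add up, since \<open>Th\<close> respects the decomposition and the squared
  norms are additive.\<close>

lemma hs_norm_Th_traceless:
  assumes sc: "strictly_contractive n Th C" and X: "X \<in> carrier_mat n n" and tr: "mtrace X = 0"
  shows "(hs_norm (Th X))\<^sup>2 \<le> C * (hs_norm X)\<^sup>2"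
proof -
  obtain A B where AB: "hermitian_mat n A" "hermitian_mat n B" "X = A + \<i> \<cdot>\<^sub>m B"
    using cartesian_decomposition[OF X] by metis
  have c: "A \<in> carrier_mat n n" "B \<in> carrier_mat n n" using AB by (auto simp: hermitian_mat_def)
  have "mtrace A + \<i> * mtrace B = 0"
    using tr c unfolding AB(3) by (simp add: mtrace_add[of _ n] mtrace_smult[of _ n])
  hence "mtrace A = 0" "mtrace B = 0"
    using hermitian_mtrace_real[OF AB(1)] hermitian_mtrace_real[OF AB(2)]
    by (auto simp: complex_eq_iff)
  hence "(hs_norm (Th A))\<^sup>2 \<le> C * (hs_norm A)\<^sup>2" "(hs_norm (Th B))\<^sup>2 \<le> C * (hs_norm B)\<^sup>2"
    using hs_norm_Th_hermitian[OF sc] AB by auto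
  thus ?thesis
    unfolding AB(3) positive_map_cartesian[OF Th_positive AB(1,2)] hs_norm_cartesian[OF AB(1,2)]
      hs_norm_cartesian[OF positive_map_hermitian[OF Th_positive AB(1)]
        positive_map_hermitian[OF Th_positive AB(2)]]
    by (simp add: algebra_simps)
qed

section \<open>Ergodicity, spectrum and entropy gain\<close>

lemma ergodic:
  assumes n: "0 < n" and sc: "strictly_contractive n Th C" and X: "X \<in> carrier_mat n n"
  shows "Th X = X \<longleftrightarrow> (\<exists>\<chi>. X = \<chi> \<cdot>\<^sub>m 1\<^sub>m n)"
proof
  assume "\<exists>\<chi>. X = \<chi> \<cdot>\<^sub>m 1\<^sub>m n"
  thus "Th X = X" using linear_map_onD(3)[OF Th_linear, of "1\<^sub>m n"] Th_one by auto
next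
  assume fp: "Th X = X"
  \<comment> \<open>This choice makes \<open>Y\<close> traceless. Being fixed by \<open>Th\<close>
    as well, \<open>Y\<close> has squared norm at most \<open>C\<close> times itself, and
    \<open>C < 1\<close> forces it to vanish.\<close>
  define \<chi> where "\<chi> = mtrace X / of_nat n"
  define Y where "Y = X - \<chi> \<cdot>\<^sub>m 1\<^sub>m n"
  have Y: "Y \<in> carrier_mat n n" using X by (auto simp: Y_def intro!: minus_carrier_mat)
  have "mtrace Y = 0"
    using X n mtrace_minus[of X n "\<chi> \<cdot>\<^sub>m 1\<^sub>m n"]
    by (simp add: Y_def mtrace_smult[of _ n] mtrace_one \<chi>_def)
  hence "(hs_norm (Th Y))\<^sup>2 \<le> C * (hs_norm Y)\<^sup>2" by (rule hs_norm_Th_traceless[OF sc Y])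
  moreover have "Th Y = Y"
    using linear_map_on_minus[OF Th_linear X, of "\<chi> \<cdot>\<^sub>m 1\<^sub>m n"]
      linear_map_onD(3)[OF Th_linear, of "1\<^sub>m n" \<chi>] Th_one fp by (simp add: Y_def)
  ultimately have "(1 - C) * (hs_norm Y)\<^sup>2 \<le> 0" by (simp add: algebra_simps)
  moreover have "0 < 1 - C" using sc by (simp add: strictly_contractive_def)
  ultimately have "(hs_norm Y)\<^sup>2 \<le> 0" by (simp add: mult_le_0_iff)
  hence Y0: "Y = 0\<^sub>m n n" using hs_norm_eq_0[OF Y] by simp
  have "X = \<chi> \<cdot>\<^sub>m 1\<^sub>m n"
  proof (rule eq_matI)
    fix i j assume "i < dim_row (\<chi> \<cdot>\<^sub>m 1\<^sub>m n)" "j < dim_col (\<chi> \<cdot>\<^sub>m 1\<^sub>m n)"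
    thus "X $$ (i, j) = (\<chi> \<cdot>\<^sub>m 1\<^sub>m n) $$ (i, j)"
      using arg_cong[OF Y0, of "\<lambda>M. M $$ (i, j)"] X by (auto simp: Y_def)
  qed (use X in auto)
  thus "\<exists>\<chi>. X = \<chi> \<cdot>\<^sub>m 1\<^sub>m n" by blast
qed

text \<open>Trace preservation forces an eigenvector for \<mu> different from 1 to be traceless.
  Then \<mu> is the Rayleigh quotient \<open>b / a\<close> of the squared norms of
  \<open>Th X\<close> and \<open>X\<close>, which is real, nonnegative and at most
  \<open>C\<close>.\<close>

lemma eigenvalue_bound:
  assumes sc: "strictly_contractive n Th C" and ev: "op_eigenvalue n (T \<circ> Th) \<mu>" and \<mu>: "\<mu> \<noteq> 1"
  shows "\<mu> \<in> complex_of_real ` {0 .. C}"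
proof -
  obtain X where X: "X \<in> carrier_mat n n" "X \<noteq> 0\<^sub>m n n" "T (Th X) = \<mu> \<cdot>\<^sub>m X"
    using ev by (auto simp: op_eigenvalue_def)
  have XH: "mat_adjoint X \<in> carrier_mat n n" and ThX: "Th X \<in> carrier_mat n n"
    using X(1) Th_carrier by auto
  have "mtrace X = \<mu> * mtrace X"
    using mtrace_T[OF ThX] mtrace_Th[OF X(1)] X by (simp add: mtrace_smult[of _ n])
  hence tr: "mtrace X = 0" using \<mu> by (metis mult_cancel_right1 mult.commute)
  define a where "a = (hs_norm X)\<^sup>2"
  define b where "b = (hs_norm (Th X))\<^sup>2"
  have a: "0 < a" using hs_norm_eq_0[OF X(1)] X(2) by (auto simp: a_def)
  have "complex_of_real b = mtrace (Th (mat_adjoint X) * Th X)"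
    unfolding b_def positive_map_adjoint[OF Th_positive X(1)]
    by (rule mtrace_adjoint_mult[OF ThX, symmetric])
  also have "\<dots> = mtrace (mat_adjoint X * (\<mu> \<cdot>\<^sub>m X))"
    using mtrace_dual[OF XH ThX] X(3) by simp
  also have "\<dots> = \<mu> * mtrace (mat_adjoint X * X)"
    using XH X(1) mult_smult_distrib[OF XH X(1)] mtrace_smult[of "mat_adjoint X * X" n \<mu>]
    by (simp add: mult_carrier_mat[OF XH X(1)])
  finally have "complex_of_real b = \<mu> * complex_of_real a"
    using mtrace_adjoint_mult[OF X(1)] by (simp add: a_def)
  hence "\<mu> = complex_of_real (b / a)" using a by (simp add: field_simps)
  moreover have "b \<le> C * a"
    using hs_norm_Th_traceless[OF sc X(1) tr] by (simp add: a_def b_def)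
  hence "b / a \<in> {0 .. C}" using a by (simp add: field_simps b_def)
  ultimately show ?thesis by blast
qed

lemma entropy_gain:
  assumes \<sigma>: "\<sigma> \<in> density n"
  shows "((hs_norm \<sigma>)\<^sup>2 - (hs_norm (Th \<sigma>))\<^sup>2) / 2 \<le> vn_entropy (Th \<sigma>) - vn_entropy \<sigma>"
proof -
  have psd: "psd n \<sigma>" and tr: "mtrace \<sigma> = 1" and c: "\<sigma> \<in> carrier_mat n n"
    using \<sigma> by (auto simp: density_def psd_def)
  have "psd n (Th \<sigma>)" using Th_positive psd by (simp add: positive_map_def)
  then obtain V q where sq: "spectral_form n (Th \<sigma>) V q" using psd_spectral by metis
  obtain U p where sp: "spectral_form n \<sigma> U p" and p0: "\<And>i. i < n \<Longrightarrow> 0 \<le> p i"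
    using psd_spectral[OF psd] by metis
  note U = spectral_formD[OF sp] and V = spectral_formD[OF sq]
  have p1: "p i \<le> 1" if "i < n" for i
  proof -
    have "(\<Sum>i<n. p i) = 1" using mtrace_spectral[OF sp] tr by (metis of_real_eq_1_iff)
    moreover have "p i \<le> (\<Sum>i<n. p i)" using p0 that by (intro member_le_sum) auto
    ultimately show ?thesis by simp
  qed
  let ?u = "\<lambda>i. col U i" and ?v = "\<lambda>j. col V j"
  have uc: "?u i \<in> carrier_vec n" "?v i \<in> carrier_vec n" for i
    using col_dim[of U i] col_dim[of V i] carrier_matD(1)[OF U(1)] carrier_matD(1)[OF V(1)] by simp_all
  \<comment> \<open>The probability of a transition from the eigenvector \<open>i\<close> of
    \<sigma> to the eigenvector \<open>j\<close> of \<open>Th \<sigma>\<close>. Rows sum to one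
    because \<open>T\<close> preserves the trace, columns because \<open>Th\<close> does.\<close>
  define D where "D j i = Re (qform (T (outer n (?v j))) (?u i))" for i j
  have Tpsd: "psd n (T (outer n (?v j)))" for j
    using T_positive psd_outer[OF uc(2)] by (simp add: positive_map_def)
  have Dc: "qform (T (outer n (?v j))) (?u i) = complex_of_real (D j i)" and D0: "0 \<le> D j i" for i j
    using Tpsd[of j] uc(1)[of i] by (auto simp: psd_iff_qform D_def less_eq_complex_def complex_eq_iff)
  have tr_outer: "mtrace (outer n (col W i)) = 1" if "unitary_mat n W" "i < n" for W i
  proof -
    have W: "W \<in> carrier_mat n n" "mat_adjoint W * W = 1\<^sub>m n" using that by (auto simp: unitary_mat_def)
    have "mtrace (outer n (col W i)) = qform (1\<^sub>m n) (col W i)"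
      using mtrace_mult_outer[of "1\<^sub>m n" n "col W i"] left_mult_one_mat[OF outer_carrier] W that
      by simp
    also have "\<dots> = 1" using qform_col[of "1\<^sub>m n" n W i] W that by simp
    finally show ?thesis .
  qed
  have Tc: "T (outer n (?v j)) \<in> carrier_mat n n" for j by (rule T_carrier) simp
  have row: "(\<Sum>i<n. D j i) = 1" if "j < n" for j
  proof -
    have "complex_of_real (\<Sum>i<n. D j i) = mtrace (T (outer n (?v j)))"
      using mtrace_unitary[OF U(3) Tc] by (simp add: Dc)
    also have "\<dots> = 1" using mtrace_T[of "outer n (?v j)"] tr_outer[OF V(3) that] by simp
    finally show ?thesis by (simp only: of_real_eq_1_iff)
  qed
  have col: "(\<Sum>j<n. D j i) = 1" if "i < n" for i
  proof -
    \<comment> \<open>Read through duality, the same weight is a diagonal entry of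
      \<open>Th (outer n (?u i))\<close> in the eigenbasis of \<open>Th \<sigma>\<close>.\<close>
    have "complex_of_real (D j i) = qform (Th (outer n (?u i))) (?v j)" for j
      using mtrace_mult_outer[OF Tc uc(1), of j i] qform_Th[OF outer_carrier uc(2), of "?u i" j]
        mtrace_mult_comm[OF Tc outer_carrier, of j "?u i"] by (simp add: Dc)
    hence "complex_of_real (\<Sum>j<n. D j i) = mtrace (Th (outer n (?u i)))"
      using mtrace_unitary[OF V(3) Th_carrier[OF outer_carrier]] by simp
    also have "\<dots> = 1" using mtrace_Th[of "outer n (?u i)"] tr_outer[OF U(3) that] by simp
    finally show ?thesis by (simp only: of_real_eq_1_iff)
  qed
  have q: "q j = (\<Sum>i<n. D j i * p i)" if "j < n" for j
  proof -
    have "complex_of_real (q j) = mtrace (\<sigma> * T (outer n (?v j)))"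
      using qform_spectral[OF sq that] qform_Th[OF c uc(2)] by simp
    also have "\<dots> = complex_of_real (\<Sum>i<n. D j i * p i)"
      using mtrace_spectral_mult[OF sp Tc] by (simp add: Dc mult.commute)
    finally show ?thesis by (simp only: of_real_eq_iff)
  qed
  have "((\<Sum>i<n. (p i)\<^sup>2) - (\<Sum>j<n. (q j)\<^sup>2)) / 2
      \<le> (\<Sum>i<n. p i * ln (p i)) - (\<Sum>j<n. q j * ln (q j))"
    using D0 row col q p0 p1 by (intro doubly_stochastic_entropy_gain[where D = D]) auto
  thus ?thesis
    by (simp add: vn_entropy_def trace_fun_spectral[OF sp] trace_fun_spectral[OF sq]
        hs_norm_spectral[OF sp] hs_norm_spectral[OF sq])
qed

text \<open>The maximally mixed state is fixed by \<open>Th\<close>, and subtracting it lowers the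
  squared norms of \<sigma> and \<open>Th \<sigma>\<close> by the same amount. So the difference in
  \<open>entropy_gain\<close> may be computed from the traceless parts, where the contraction bound
  leaves the factor \<open>1 - C\<close>.\<close>

lemma entropy_gain_contractive:
  assumes n: "0 < n" and sc: "strictly_contractive n Th C" and \<sigma>: "\<sigma> \<in> density n"
  shows "(1 - C) / 2 * (hs_norm (\<sigma> - (1 / of_nat n) \<cdot>\<^sub>m 1\<^sub>m n))\<^sup>2 \<le> vn_entropy (Th \<sigma>) - vn_entropy \<sigma>"
proof -
  have psd: "psd n \<sigma>" and tr: "mtrace \<sigma> = 1" and c: "\<sigma> \<in> carrier_mat n n"
    using \<sigma> by (auto simp: density_def psd_def)
  let ?m = "(1 / of_nat n) \<cdot>\<^sub>m 1\<^sub>m n :: complex mat"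
  have m: "?m \<in> carrier_mat n n" by simp
  have herm: "hermitian_mat n \<sigma>" by (rule psd_hermitian[OF psd])
  have Thm: "Th (\<sigma> - ?m) = Th \<sigma> - ?m"
    using linear_map_on_minus[OF Th_linear c m] linear_map_onD(3)[OF Th_linear, of "1\<^sub>m n"] Th_one
    by simp
  have "mtrace (\<sigma> - ?m) = 0"
    using n mtrace_minus[OF c m] tr by (simp add: mtrace_smult[of _ n] mtrace_one)
  hence "(hs_norm (Th \<sigma> - ?m))\<^sup>2 \<le> C * (hs_norm (\<sigma> - ?m))\<^sup>2"
    using hs_norm_Th_traceless[OF sc, of "\<sigma> - ?m"] minus_carrier_mat[OF m] Thm by simp
  moreover have "(hs_norm (\<sigma> - ?m))\<^sup>2 = (hs_norm \<sigma>)\<^sup>2 - 1 / real n"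
    by (rule hs_norm_minus_maximally_mixed[OF n herm tr])
  moreover have "(hs_norm (Th \<sigma> - ?m))\<^sup>2 = (hs_norm (Th \<sigma>))\<^sup>2 - 1 / real n"
    using mtrace_Th[OF c] tr
    by (intro hs_norm_minus_maximally_mixed[OF n positive_map_hermitian[OF Th_positive herm]]) simp
  moreover have "(1 - C) / 2 * x = (x - C * x) / 2" for x by (simp add: algebra_simps)
  ultimately show ?thesis using entropy_gain[OF \<sigma>] by simp
qed

end

theorem theorem2:
  fixes N :: nat and T Th :: "complex mat \<Rightarrow> complex mat" and C :: real
  assumes "N \<ge> 2"
    and "channel N T"
    and "is_dual N T Th"
    and "Th (1\<^sub>m N) = 1\<^sub>m N"
    and "strictly_contractive N Th C"
  shows "(\<forall>X \<in> carrier_mat N N. Th X = X \<longleftrightarrow> (\<exists>\<chi>::complex. X = \<chi> \<cdot>\<^sub>m 1\<^sub>m N))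
       \<and> (\<exists>\<gamma>::real. \<gamma> \<ge> 1 - C \<and>
            (\<forall>\<mu>. op_eigenvalue N (T \<circ> Th) \<mu> \<longrightarrow>
                 \<mu> \<in> complex_of_real ` {0 .. 1 - \<gamma>} \<or> \<mu> = 1))
       \<and> (\<forall>\<sigma> \<in> density N.
            vn_entropy (Th \<sigma>) - vn_entropy \<sigma> \<ge>
              (1 - C) / 2 * (hs_norm (\<sigma> - (1 / of_nat N) \<cdot>\<^sub>m 1\<^sub>m N))\<^sup>2)"
proof -
  interpret bistochastic_channel N T Th
    by unfold_locales (use assms in auto)
  have N: "0 < N" using assms(1) by simp
  note sc = assms(5)
  show ?thesis
  \<comment> \<open>With \<gamma> equal to \<open>1 - C\<close> the spectral interval is exactly
    that of \<open>eigenvalue_bound\<close>.\<close>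
  proof (intro conjI ballI exI[of _ "1 - C"] allI impI)
    fix \<mu> assume "op_eigenvalue N (T \<circ> Th) \<mu>"
    thus "\<mu> \<in> complex_of_real ` {0 .. 1 - (1 - C)} \<or> \<mu> = 1"
      using eigenvalue_bound[OF sc] by auto
  qed (use ergodic[OF N sc] entropy_gain_contractive[OF N sc] in auto)
qed

end
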